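(* Fix $c>0$ and set $k_n:=\lfloor c\log n\rfloor$. Then $$p_{k_n}^{(n)}=\mathbb{P}\big(f_0(T_n)=k_n+2\big)=n^{-I(c)+o(1)}$$ as $n\to\infty$, where, for $x>0$, $$I(x)=x\log\!\big(\tfrac x2\big)+x\,\operatorname{arsinh}(2x)-x-\tfrac12\sqrt{1+4x^2}+\tfrac32.$$
   Context: Let $T\subset\mathbb{R}^2$ be the triangle with vertices $(0,0)$, $\mathbf{v}_1=(1,0)$, $\mathbf{v}_2=(0,1)$. For $n\ge 0$ let $\mathbf{X}_1,\dots,\mathbf{X}_n$ be independent uniformly distributed random points in $T$ and $T_n:=\operatorname{conv}\{\mathbf{v}_1,\mathbf{v}_2,\mathbf{X}_1,\dots,\mathbf{X}_n\}$. Let $f_0(T_n)$ be the number of vertices of $T_n$ (including $\mathbf{v}_1,\mathbf{v}_2$) and $p_k^{(n)}:=\mathbb{P}(f_0(T_n)=k+2)$ for $k\in\{0,\dots,n\}$. *)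

theory Defs
  imports "HOL-Probability.Probability"
begin

definition T :: "(real \<times> real) set" where
  "T = convex hull {(0, 0), (1, 0), (0, 1)}"

(* The deterministic points are v_1 and v_2 only; the vertex (0,0) of T is not added to the hull. *)
definition random_polygon :: "nat \<Rightarrow> (nat \<Rightarrow> 'a \<Rightarrow> real \<times> real) \<Rightarrow> 'a \<Rightarrow> (real \<times> real) set" where
  "random_polygon n X \<omega> = convex hull ({(1, 0), (0, 1)} \<union> (\<lambda>i. X i \<omega>) ` {1..n})"

(* The degenerate polygon for n = 0 is a segment and has two vertices. *)
definition f0 :: "(real \<times> real) set \<Rightarrow> nat" where
  "f0 P = card {v. v extreme_point_of P}"

definition vertex_prob :: "'a measure \<Rightarrow> (nat \<Rightarrow> 'a \<Rightarrow> real \<times> real) \<Rightarrow> nat \<Rightarrow> nat \<Rightarrow> real" where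
  "vertex_prob M X n k = \<P>(\<omega> in M. f0 (random_polygon n X \<omega>) = k + 2)"

definition rate :: "real \<Rightarrow> real" where
  "rate x = x * ln (x / 2) + x * arsinh (2 * x) - x - (1 / 2) * sqrt (1 + 4 * x\<^sup>2) + 3 / 2"

end

theory Submission
  imports Defs "HOL-Real_Asymp.Real_Asymp"
begin

text \<open>
  The proof finds the law of the number of vertices from a one-step recursion and then reads off
  its local large deviations from the growth of the generating function.

  \<^bold>\<open>Recursion.\<close> Among the random points let y be the one for which the ray from (1,0)
  makes the smallest angle with the edge from (1,0) to (0,0). It is the neighbour of (1,0) on the
  chain. If the line through (1,0) and y meets the vertical axis in o, the other points lie in the
  triangle (1,0), o, (0,1), and y divides it into the triangle (1,0), y, (0,1), whose points are
  hidden, and the triangle y, o, (0,1). An affine map takes the latter to T, with y going to (1,0),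
  and the vertices other than (1,0) are those of the chain of the points in it. If there are m of
  them, the number of vertices is one more than for a chain of m uniform points. Given y the two
  area shares are explicit, and integrating the binomial weights over y is a Beta integral, which gives Buchta's
  recursion \<open>n(n+1) p_k(n) = 2 \<Sum>_{m<n} (n-m) p_{k-1}(m)\<close> for the probability \<open>p_k(n)\<close> of
  k + 2 vertices (lemma \<open>vertex_prob_eq_chain_prob\<close>).

  \<^bold>\<open>Growth.\<close> The generating function \<open>G_n(z)\<close> of \<open>p_k(n)\<close> satisfies
  \<open>n(n+1) G_n = 2z \<Sum>_{m<n} (n-m) G_m\<close>. The numbers \<open>u_n = (n+a choose n)\<close>, of order \<open>n^a\<close>,
  satisfy the same relation with \<open>n(n+1+a) (2z) / ((a+1)(a+2))\<close> in place of \<open>n(n+1)\<close>, hence are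
  eventually super- or subsolutions according to the sign of \<open>(a+1)(a+2) - 2z\<close>. So \<open>G_n(z)\<close> grows
  like \<open>n\<close> to the power \<open>\<Lambda>(z) = (sqrt(1+8z) - 3)/2\<close>, the root of \<open>(a+1)(a+2) = 2z\<close>, up to
  \<open>n^{o(1)}\<close>.

  \<^bold>\<open>Large deviations.\<close> The rate function is the Legendre transform
  \<open>sup_z (c log z - \<Lambda>(z))\<close>, attained at an explicit z (definition \<open>tilt\<close>). The Chernoff
  bound \<open>p_k(n) \<le> z^{-k} G_n(z)\<close> is the upper bound. For the lower bound, exponential tilting
  shows only that some k in a narrow window around \<open>c log n\<close> is likely enough
  (\<open>exists_likely_value_in_window\<close>). The floor of \<open>c log n\<close> lies between two such windows, and
  log-concavity of \<open>k \<mapsto> p_k(n)\<close> (\<open>chain_prob_log_concave\<close>) carries the bound to it. Log-concavity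
  holds because the kernel \<open>(n-m)\<^sup>+\<close> is totally positive of order two.
\<close>

section \<open>The extreme points of a convex chain\<close>

lemma T_eq: "T = {p. 0 \<le> fst p \<and> 0 \<le> snd p \<and> fst p + snd p \<le> 1}"
proof (intro set_eqI iffI)
  fix p assume "p \<in> T"
  then show "p \<in> {p. 0 \<le> fst p \<and> 0 \<le> snd p \<and> fst p + snd p \<le> 1}"
    unfolding T_def convex_hull_3 by (auto simp: algebra_simps)
next
  fix p :: "real \<times> real" assume p: "p \<in> {p. 0 \<le> fst p \<and> 0 \<le> snd p \<and> fst p + snd p \<le> 1}"
  then have "p = (1 - fst p - snd p) *\<^sub>R (0,0) + fst p *\<^sub>R (1,0) + snd p *\<^sub>R (0,1)"
    by (cases p) auto
  with p show "p \<in> T"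
    unfolding T_def convex_hull_3
    by (intro CollectI exI[of _ "1 - fst p - snd p"] exI[of _ "fst p"] exI[of _ "snd p"]) auto
qed

lemma convex_T: "convex T"
  by (simp add: T_def)

lemma extreme_point_of_convex_hull_finite_iff:
  fixes K :: "'a::euclidean_space set"
  assumes "finite K"
  shows "v extreme_point_of (convex hull K) \<longleftrightarrow> v \<in> K \<and> v \<notin> convex hull (K - {v})"
proof
  assume v: "v extreme_point_of (convex hull K)"
  then have "v \<in> K" by (rule extreme_point_of_convex_hull)
  moreover have "convex hull (K - {v}) \<subseteq> convex hull K - {v}"
    using v extreme_point_of_stillconvex[of "convex hull K" v] hull_subset[of K convex]
    by (intro hull_minimal) auto
  ultimately show "v \<in> K \<and> v \<notin> convex hull (K - {v})" by auto
next
  assume v: "v \<in> K \<and> v \<notin> convex hull (K - {v})"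
  then show "v extreme_point_of (convex hull K)"
    using extreme_point_of_convex_hull_insert[of "K - {v}" v] assms by (simp add: insert_absorb)
qed

lemma finite_extreme_points_of_hull:
  "finite K \<Longrightarrow> finite {v. v extreme_point_of (convex hull K)}"
  by (rule finite_subset[of _ K]) (auto dest: extreme_point_of_convex_hull)

lemma f0_affine_image:
  fixes g :: "real \<times> real \<Rightarrow> real \<times> real"
  assumes "linear g" "inj g"
  shows "f0 (convex hull ((\<lambda>x. a + g x) ` K)) = f0 (convex hull K)"
proof -
  have "convex hull ((\<lambda>x. a + g x) ` K) = (\<lambda>x. a + x) ` (convex hull (g ` K))"
    by (simp add: convex_hull_translation[symmetric] image_image)
  also have "\<dots> = (\<lambda>x. a + g x) ` (convex hull K)"
    by (simp add: convex_hull_linear_image[OF \<open>linear g\<close>, symmetric] image_image)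
  finally have eq: "convex hull ((\<lambda>x. a + g x) ` K) = (\<lambda>x. a + x) ` (g ` (convex hull K))"
    by (simp add: image_image)
  have ext: "g v extreme_point_of (g ` (convex hull K)) \<longleftrightarrow> v extreme_point_of (convex hull K)" for v
    unfolding extreme_point_of_def
    by (simp only: Set.ball_simps open_segment_linear_image[OF assms] inj_image_mem_iff[OF assms(2)])
  have "{v. v extreme_point_of (g ` (convex hull K))} = g ` {v. v extreme_point_of (convex hull K)}"
  proof (intro set_eqI iffI)
    fix v assume v: "v \<in> {v. v extreme_point_of (g ` (convex hull K))}"
    then obtain w where "v = g w" by (auto simp only: extreme_point_of_def mem_Collect_eq)
    with v ext show "v \<in> g ` {v. v extreme_point_of (convex hull K)}" by auto
  qed (use ext in auto)
  then show ?thesis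
    unfolding f0_def eq extreme_points_of_translation
    by (simp add: card_image inj_on_def inj_eq[OF \<open>inj g\<close>])
qed

lemma f0_segment: "f0 (convex hull {(1,0),(0,1)}) = 2"
proof -
  have "{v. v extreme_point_of convex hull {(1::real,0::real),(0,1)}} = {(1,0),(0,1)}"
    by (auto simp: extreme_point_of_convex_hull_2)
  then show ?thesis unfolding f0_def by simp
qed

text \<open>
  Adding a vertex B on the ray from (0,0) through (1,0), beyond (1,0), adds exactly one extreme point.
  Points of S outside T lie in the triangle B, (1,0), (0,1) and disappear into the hull. An extreme
  point v of the old hull stays extreme: seen from v, the new point B hides behind the edge from
  (1,0) to (0,1), unless v is an end of this edge, and then a coordinate function separates.
\<close>

lemma f0_beyond_vertex:
  fixes b :: real and S :: "(real \<times> real) set"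
  assumes b: "b > 1" and fin: "finite S"
    and S: "\<And>x. x \<in> S \<Longrightarrow> 0 \<le> fst x \<and> 0 < snd x \<and> fst x + b * snd x \<le> b"
  shows "f0 (convex hull ({(b,0),(1,0),(0,1)} \<union> S)) =
         Suc (f0 (convex hull ({(1,0),(0,1)} \<union> (S \<inter> T))))"
proof -
  define B where "B = (b, 0::real)"
  define K where "K = {(1,0),(0,1)} \<union> (S \<inter> T)"
  have finK: "finite K" using fin by (simp add: K_def)
  have KT: "K \<subseteq> T" by (auto simp: K_def T_eq)
  have KTh: "convex hull K \<subseteq> T" using KT convex_T by (simp add: hull_minimal)
  have B_notin: "B \<notin> T" using b by (auto simp: T_eq B_def)
  \<comment> \<open>A point of the outer triangle beyond the line from (1,0) to (0,1) lies in the triangle B, (1,0), (0,1).\<close>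
  have outside: "x \<in> convex hull {B, (1,0), (0,1)}" if x: "x \<in> S" "x \<notin> T" for x
  proof -
    obtain p r where pr: "x = (p, r)" by (cases x)
    have c: "0 \<le> p" "0 < r" "p + b * r \<le> b" "p + r > 1"
      using S[OF x(1)] x(2) pr by (auto simp: T_eq)
    define u where "u = (p + r - 1) / (b - 1)"
    have ub: "u * (b - 1) = p + r - 1" using b by (simp add: u_def)
    have u0: "0 \<le> u" using b c by (simp add: u_def)
    have "u * (b - 1) = p + r - 1" by (fact ub)
    also have "\<dots> \<le> (1 - r) * (b - 1)" using c by (simp add: algebra_simps)
    finally have "u \<le> 1 - r" using b by simp
    moreover have "x = u *\<^sub>R B + (1 - u - r) *\<^sub>R (1,0) + r *\<^sub>R (0,1)"
      using ub by (simp add: pr B_def algebra_simps)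
    ultimately show ?thesis
      unfolding convex_hull_3 using u0 c
      by (intro CollectI exI[of _ u] exI[of _ "1 - u - r"] exI[of _ r]) auto
  qed
  have hull_eq: "convex hull ({(b,0),(1,0),(0,1)} \<union> S) = convex hull (insert B K)"
  proof (rule antisym; rule hull_minimal)
    show "{(b, 0), (1, 0), (0, 1)} \<union> S \<subseteq> convex hull insert B K"
    proof
      fix x assume "x \<in> {(b, 0), (1, 0), (0, 1)} \<union> S"
      then consider "x \<in> insert B K" | "x \<in> S" "x \<notin> T" by (auto simp: B_def K_def)
      then show "x \<in> convex hull insert B K"
      proof cases
        case 2
        have "{B, (1,0), (0,1)} \<subseteq> insert B K" by (auto simp: K_def)
        then have "convex hull {B, (1,0), (0,1)} \<subseteq> convex hull insert B K" by (rule hull_mono)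
        with outside[OF 2] show ?thesis by (rule rev_subsetD)
      qed (simp add: hull_inc)
    qed
    show "insert B K \<subseteq> convex hull ({(b, 0), (1, 0), (0, 1)} \<union> S)"
      by (rule subset_trans[OF _ hull_subset]) (auto simp: B_def K_def)
  qed auto
  have ext_B: "B extreme_point_of (convex hull (insert B K))"
    by (rule extreme_point_of_convex_hull_insert[OF finK]) (use KTh B_notin in blast)
  have ext_K: "v extreme_point_of (convex hull (insert B K))" if v: "v extreme_point_of (convex hull K)" for v
  proof -
    have vK: "v \<in> K" and vn: "v \<notin> convex hull (K - {v})"
      using v extreme_point_of_convex_hull_finite_iff[OF finK] by auto
    have vB: "v \<noteq> B" using vK KT B_notin by blast
    have "(1,0) \<in> K" "(0,1) \<in> K" "(1,0) \<noteq> (0::real, 1::real)" by (simp_all add: K_def)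
    then have ne: "K - {v} \<noteq> {}" by blast
    have "v \<notin> convex hull (insert B (K - {v}))"
    proof
      assume "v \<in> convex hull (insert B (K - {v}))"
      then obtain u w b' where u: "u \<ge> 0" "w \<ge> 0" "u + w = 1" and b': "b' \<in> convex hull (K - {v})"
        and veq: "v = u *\<^sub>R B + w *\<^sub>R b'"
        unfolding convex_hull_insert[OF ne] by auto
      have u_pos: "u > 0" using u vn b' veq by (cases "u = 0") auto
      have w_pos: "w > 0" using u vB veq by (cases "w = 0") auto
      have "convex hull (K - {v}) \<subseteq> convex hull K" by (rule hull_mono) blast
      then have b'T: "b' \<in> T" using b' KTh by blast
      consider "v = (1,0)" | "v = (0,1)" | "v \<noteq> (1,0)" "v \<noteq> (0,1)" by auto
      then show False
      proof cases
        case 1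
        then have "w * snd b' = 0" using veq by (simp add: B_def prod_eq_iff)
        then have z: "snd b' = 0" using w_pos by simp
        have "convex hull (K - {v}) \<subseteq> {x. snd x > 0}"
        proof (rule hull_minimal)
          show "K - {v} \<subseteq> {x. snd x > 0}" using S 1 by (auto simp: K_def)
          show "convex {x::real \<times> real. snd x > 0}"
            using convex_halfspace_gt[of 0 "(0,1)::real\<times>real"] by (simp add: inner_prod_def)
        qed
        with b' z show False by auto
      next
        case 2
        then have "0 = u * b + w * fst b'" using veq by (simp add: B_def prod_eq_iff)
        moreover have "u * b > 0" "w * fst b' \<ge> 0" using u_pos b w_pos b'T by (auto simp: T_eq)
        ultimately show False by linarith
      next
        case 3
        \<comment> \<open>The segment from v towards B leaves T at a point r of the edge between (1,0) and (0,1),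
            so v lies between r and b'.\<close>
        define \<theta> where "\<theta> = (1 - fst v - snd v) / (b - fst v - snd v)"
        define r where "r = (1 - \<theta>) *\<^sub>R v + \<theta> *\<^sub>R B"
        have vT: "0 \<le> fst v" "0 \<le> snd v" "fst v + snd v \<le> 1" using vK KT by (auto simp: T_eq)
        have th: "0 \<le> \<theta>" "\<theta> \<le> 1" using vT b by (auto simp: \<theta>_def)
        have "\<theta> * (b - fst v - snd v) = 1 - fst v - snd v" using vT b by (simp add: \<theta>_def)
        then have rsum: "fst r + snd r = 1" by (simp add: r_def B_def algebra_simps)
        have r0: "fst r \<ge> 0" "snd r \<ge> 0" using th vT b by (auto simp: r_def B_def)
        have "r = fst r *\<^sub>R (1,0) + snd r *\<^sub>R (0,1)" by (simp add: prod_eq_iff)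
        then have "r \<in> convex hull {(1,0),(0,1)}"
          unfolding convex_hull_2 using rsum r0 by blast
        moreover have "{(1,0),(0,1)} \<subseteq> K - {v}" using 3 by (auto simp: K_def)
        ultimately have rK: "r \<in> convex hull (K - {v})" using hull_mono[of _ "K - {v}" convex] by blast
        define s where "s = u + w * \<theta>"
        have s: "s > 0" using u_pos w_pos th by (simp add: s_def add_pos_nonneg)
        have w: "w = 1 - u" using u by simp
        have "s = \<theta> + u * (1 - \<theta>)" unfolding s_def w by (simp add: algebra_simps)
        then have "s *\<^sub>R v = (\<theta> + u * (1 - \<theta>)) *\<^sub>R v" by simp
        also have "\<dots> = \<theta> *\<^sub>R v + u *\<^sub>R (1 - \<theta>) *\<^sub>R v" by (simp add: algebra_simps)
        also have "\<theta> *\<^sub>R v = \<theta> *\<^sub>R u *\<^sub>R B + \<theta> *\<^sub>R w *\<^sub>R b'" by (subst veq) (simp add: algebra_simps)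
        also have "u *\<^sub>R (1 - \<theta>) *\<^sub>R v = u *\<^sub>R r - u *\<^sub>R \<theta> *\<^sub>R B" by (simp add: r_def algebra_simps)
        finally have "s *\<^sub>R v = u *\<^sub>R r + (w * \<theta>) *\<^sub>R b'" by (simp add: algebra_simps)
        then have "(1 / s) *\<^sub>R s *\<^sub>R v = (1 / s) *\<^sub>R (u *\<^sub>R r + (w * \<theta>) *\<^sub>R b')" by simp
        then have "v = (u / s) *\<^sub>R r + (w * \<theta> / s) *\<^sub>R b'" using s by (simp add: algebra_simps)
        moreover have "u / s + w * \<theta> / s = 1" using s by (simp add: s_def add_divide_distrib[symmetric])
        moreover have "0 \<le> u / s" "0 \<le> w * \<theta> / s" using s u th by auto
        ultimately have "v \<in> convex hull (K - {v})"
          using convexD[OF convex_convex_hull rK b', of "u / s" "w * \<theta> / s"] by simp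
        with vn show False ..
      qed
    qed
    moreover have "insert B K - {v} = insert B (K - {v})" using vB by auto
    ultimately show ?thesis
      using extreme_point_of_convex_hull_finite_iff[of "insert B K"] finK vK by simp
  qed
  have "{v. v extreme_point_of (convex hull (insert B K))} =
        insert B {v. v extreme_point_of (convex hull K)}"
  proof (intro set_eqI iffI)
    fix v assume v: "v \<in> {v. v extreme_point_of (convex hull (insert B K))}"
    show "v \<in> insert B {v. v extreme_point_of (convex hull K)}"
    proof (cases "v = B")
      case False
      then have vK: "v \<in> K" "v \<notin> convex hull (insert B K - {v})"
        using v extreme_point_of_convex_hull_finite_iff[of "insert B K"] finK by auto
      moreover have "convex hull (K - {v}) \<subseteq> convex hull (insert B K - {v})"
        by (rule hull_mono) auto
      ultimately show ?thesis using extreme_point_of_convex_hull_finite_iff[OF finK] by auto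
    qed simp
  qed (use ext_B ext_K in auto)
  moreover have "B \<notin> {v. v extreme_point_of (convex hull K)}"
    using KTh B_notin by (auto simp: extreme_point_of_def)
  ultimately have "f0 (convex hull (insert B K)) = Suc (f0 (convex hull K))"
    unfolding f0_def using finite_extreme_points_of_hull[OF finK] by simp
  then show ?thesis unfolding hull_eq K_def .
qed

text \<open>
  The affine map that fixes (0,1), takes y to (1,0), and takes to (0,0) the point where the line
  through (1,0) and y meets the vertical axis. The numerator of its second coordinate vanishes exactly
  on that line. The vertex (1,0) itself goes to a point beyond (1,0).
\<close>

definition cap_map :: "real \<times> real \<Rightarrow> real \<times> real \<Rightarrow> real \<times> real" where
  "cap_map y x = (fst x / fst y,
     (snd x * (1 - fst y) - snd y * (1 - fst x)) / (1 - fst y - snd y))"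

text \<open>
  The hypothesis on the second coordinate says that S lies strictly above the line through (1,0) and
  y. Since the number of extreme points is an affine invariant, applying the map brings the configuration
  to the one of the previous lemma with B the image of (1,0).
\<close>

lemma f0_split_at_first_vertex:
  fixes y :: "real \<times> real" and S :: "(real \<times> real) set"
  assumes y: "fst y > 0" "snd y \<ge> 0" "fst y + snd y < 1" and fin: "finite S" and ST: "S \<subseteq> T"
    and above: "\<And>x. x \<in> S \<Longrightarrow> snd (cap_map y x) > 0"
  shows "f0 (convex hull ({(1,0),(0,1)} \<union> insert y S)) =
         Suc (f0 (convex hull ({(1,0),(0,1)} \<union> (cap_map y ` S \<inter> T))))"
proof -
  define l s D where "l = fst y" and "s = snd y" and "D = 1 - fst y - snd y"
  have D: "D > 0" and l: "l > 0" "l < 1" and s: "s \<ge> 0" using y by (auto simp: D_def l_def s_def)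
  have Dls: "D = 1 - l - s" by (simp add: D_def l_def s_def)
  define g where "g = (\<lambda>x::real \<times> real. (fst x / l, (snd x * (1 - l) + s * fst x) / D))"
  have cap: "cap_map y = (\<lambda>x. (0, - s / D) + g x)"
    by (auto simp: cap_map_def g_def D_def l_def s_def fun_eq_iff add_divide_distrib[symmetric] algebra_simps)
  have "linear g"
    by (rule linearI) (auto simp: g_def add_divide_distrib[symmetric] algebra_simps)
  moreover have "inj g"
    using D l by (auto simp: inj_def g_def)
  ultimately have "f0 (convex hull ({(1,0),(0,1)} \<union> insert y S)) =
     f0 (convex hull (cap_map y ` ({(1,0),(0,1)} \<union> insert y S)))"
    unfolding cap by (simp only: f0_affine_image)
  also have "cap_map y ` ({(1,0),(0,1)} \<union> insert y S) = {(1/l,0),(1,0),(0,1)} \<union> cap_map y ` S"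
  proof -
    have "cap_map y (1,0) = (1/l,0)" by (simp add: cap_map_def l_def)
    moreover have "cap_map y (0,1) = (0,1)" using y by (simp add: cap_map_def)
    moreover have "cap_map y y = (1,0)" using y by (simp add: cap_map_def)
    ultimately show ?thesis by auto
  qed
  also have "f0 (convex hull \<dots>) = Suc (f0 (convex hull ({(1,0),(0,1)} \<union> (cap_map y ` S \<inter> T))))"
  proof (rule f0_beyond_vertex)
    show "1 < 1 / l" using l by simp
    show "finite (cap_map y ` S)" using fin by simp
    fix z assume "z \<in> cap_map y ` S"
    then obtain x where x: "x \<in> S" "z = cap_map y x" by auto
    have xT: "fst x \<ge> 0" "fst x + snd x \<le> 1" using x ST by (auto simp: T_eq)
    have "z = (fst x / l, (snd x * (1 - l) - s * (1 - fst x)) / D)"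
      by (simp add: x cap_map_def D_def l_def s_def)
    then have "fst z + 1 / l * snd z = (fst x * D + (snd x * (1 - l) - s * (1 - fst x))) / (D * l)"
      using D l by (simp add: add_divide_distrib)
    also have "\<dots> = ((fst x + snd x) * (1 - l) - s) / (D * l)"
      by (rule arg_cong[of _ _ "\<lambda>t. t / (D * l)"]) (simp add: Dls algebra_simps)
    also have "\<dots> \<le> (1 * (1 - l) - s) / (D * l)"
      using D l xT by (intro divide_right_mono diff_right_mono mult_right_mono) auto
    also have "\<dots> = 1 / l" using D l by (simp add: Dls)
    finally show "0 \<le> fst z \<and> 0 < snd z \<and> fst z + 1 / l * snd z \<le> 1 / l"
      using above[OF x(1)] x xT l by (simp add: cap_map_def l_def)
  qed
  finally show ?thesis .
qed

section \<open>Measurability of the number of vertices\<close>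

text \<open>
  Extreme points of a polytope are exposed, and exposing directions form an open set. Hence a
  countable dense set of directions suffices, which makes extremality a countable condition on the
  points.
\<close>

lemma extreme_point_iff_exposed_by_dense_direction:
  fixes K D :: "(real \<times> real) set"
  assumes fin: "finite K" and D: "\<And>U. open U \<Longrightarrow> U \<noteq> {} \<Longrightarrow> \<exists>d\<in>D. d \<in> U"
  shows "v extreme_point_of (convex hull K) \<longleftrightarrow>
         v \<in> K \<and> (\<exists>d\<in>D. \<forall>w\<in>K. w \<noteq> v \<longrightarrow> d \<bullet> w < d \<bullet> v)"
proof -
  have "v \<notin> convex hull (K - {v}) \<longleftrightarrow> (\<exists>d\<in>D. \<forall>w\<in>K - {v}. d \<bullet> w < d \<bullet> v)"
  proof
    assume v: "v \<notin> convex hull (K - {v})"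
    have "closed (convex hull (K - {v}))"
      using fin by (simp add: compact_imp_closed finite_imp_compact compact_convex_hull)
    then obtain a \<beta> where a: "a \<bullet> v < \<beta>" "\<And>x. x \<in> convex hull (K - {v}) \<Longrightarrow> \<beta> < a \<bullet> x"
      using separating_hyperplane_closed_point[OF convex_convex_hull _ v] by blast
    define U where "U = (\<Inter>w\<in>K - {v}. {d. d \<bullet> w < d \<bullet> v})"
    have "open U" unfolding U_def using fin
      by (intro open_INT ballI open_Collect_less continuous_intros) auto
    moreover have "- a \<in> U"
    proof -
      have "a \<bullet> v < a \<bullet> w" if "w \<in> K - {v}" for w
        using a(1) a(2)[OF hull_inc[OF that]] by simp
      then show ?thesis by (simp add: U_def)
    qed
    ultimately obtain d where "d \<in> D" "d \<in> U" using D by blast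
    then show "\<exists>d\<in>D. \<forall>w\<in>K - {v}. d \<bullet> w < d \<bullet> v" by (auto simp: U_def)
  next
    assume "\<exists>d\<in>D. \<forall>w\<in>K - {v}. d \<bullet> w < d \<bullet> v"
    then obtain d where d: "\<forall>w\<in>K - {v}. d \<bullet> w < d \<bullet> v" by auto
    have "convex hull (K - {v}) \<subseteq> {w. d \<bullet> w < d \<bullet> v}"
      using d by (intro hull_minimal convex_halfspace_lt) auto
    then show "v \<notin> convex hull (K - {v})" by auto
  qed
  then show ?thesis
    using extreme_point_of_convex_hull_finite_iff[OF fin] by auto
qed

text \<open>
  Counting each value at its smallest index turns the cardinality of an image, which ignores
  repetitions, into a sum of measurable terms.
\<close>

lemma card_image_as_sum:
  fixes g :: "nat \<Rightarrow> 'b"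
  assumes "finite I"
  shows "real (card {v \<in> g ` I. P v}) =
         (\<Sum>i\<in>I. if P (g i) \<and> (\<forall>j\<in>I. j < i \<longrightarrow> g j \<noteq> g i) then 1 else 0)"
proof -
  let ?R = "{i\<in>I. P (g i) \<and> (\<forall>j\<in>I. j < i \<longrightarrow> g j \<noteq> g i)}"
  have "bij_betw g ?R {v \<in> g ` I. P v}"
  proof (rule bij_betw_imageI)
    show "inj_on g ?R"
    proof (rule inj_onI)
      fix i j assume "i \<in> ?R" "j \<in> ?R" "g i = g j"
      then show "i = j" by (cases i j rule: linorder_cases) auto
    qed
    have "v \<in> g ` ?R" if v: "v \<in> g ` I" "P v" for v
    proof -
      define i where "i = (LEAST i. i \<in> I \<and> g i = v)"
      have "\<exists>i. i \<in> I \<and> g i = v" using v(1) by blast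
      then have "i \<in> I \<and> g i = v" unfolding i_def by (rule LeastI_ex)
      moreover have "g j \<noteq> v" if "j \<in> I" "j < i" for j
        using not_less_Least[of j "\<lambda>i. i \<in> I \<and> g i = v"] that unfolding i_def by auto
      ultimately show ?thesis using v by (intro image_eqI[of _ _ i]) auto
    qed
    then show "g ` ?R = {v \<in> g ` I. P v}" by auto
  qed
  then have "card {v \<in> g ` I. P v} = card ?R" by (simp add: bij_betw_same_card)
  also have "real \<dots> = (\<Sum>i\<in>?R. 1)" by simp
  also have "\<dots> = (\<Sum>i\<in>I. if P (g i) \<and> (\<forall>j\<in>I. j < i \<longrightarrow> g j \<noteq> g i) then 1 else 0)"
    by (rule sum.inter_filter[OF assms])
  finally show ?thesis .
qed

lemma measurable_vertex_number:
  fixes G :: "nat \<Rightarrow> 'b \<Rightarrow> real \<times> real"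
  assumes "finite I" and G[measurable]: "\<And>i. i \<in> I \<Longrightarrow> G i \<in> borel_measurable N"
  shows "(\<lambda>\<omega>. real (f0 (convex hull ((\<lambda>i. G i \<omega>) ` I)))) \<in> borel_measurable N"
proof -
  obtain D :: "(real \<times> real) set" where cD: "countable D"
    and D: "\<And>U. open U \<Longrightarrow> U \<noteq> {} \<Longrightarrow> \<exists>d\<in>D. d \<in> U"
    using countable_dense_exists by blast
  have eq: "real (f0 (convex hull ((\<lambda>i. G i \<omega>) ` I))) =
     (\<Sum>i\<in>I. if (\<exists>d\<in>D. \<forall>k\<in>I. G k \<omega> \<noteq> G i \<omega> \<longrightarrow> d \<bullet> G k \<omega> < d \<bullet> G i \<omega>) \<and>
                 (\<forall>j\<in>I. j < i \<longrightarrow> G j \<omega> \<noteq> G i \<omega>) then 1 else 0)" for \<omega>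
    unfolding f0_def
    by (subst extreme_point_iff_exposed_by_dense_direction[OF _ D])
      (use \<open>finite I\<close> in \<open>simp_all add: card_image_as_sum\<close>)
  have [measurable]: "Measurable.pred N (\<lambda>\<omega>. G k \<omega> = G i \<omega>)" if "i \<in> I" "k \<in> I" for i k
    using that by measurable

  show ?thesis unfolding eq
  proof (intro borel_measurable_sum measurable_If borel_measurable_const)
    fix i assume i: "i \<in> I"
    have 1: "Measurable.pred N (\<lambda>\<omega>. \<exists>d\<in>D. \<forall>k\<in>I. G k \<omega> \<noteq> G i \<omega> \<longrightarrow> d \<bullet> G k \<omega> < d \<bullet> G i \<omega>)"
    proof (unfold pred_def, rule sets.sets_Collect_countable_Ex'[OF _ cD], fold pred_def)
      fix d assume "d \<in> D"
      show "Measurable.pred N (\<lambda>\<omega>. \<forall>k\<in>I. G k \<omega> \<noteq> G i \<omega> \<longrightarrow> d \<bullet> G k \<omega> < d \<bullet> G i \<omega>)"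
        using \<open>finite I\<close> i by (intro pred_intros_finite(3)) measurable
    qed
    have 2: "Measurable.pred N (\<lambda>\<omega>. \<forall>j\<in>I. j < i \<longrightarrow> G j \<omega> \<noteq> G i \<omega>)"
      using \<open>finite I\<close> i by (intro pred_intros_finite(3)) measurable
    show "{\<omega> \<in> space N. (\<exists>d\<in>D. \<forall>k\<in>I. G k \<omega> \<noteq> G i \<omega> \<longrightarrow> d \<bullet> G k \<omega> < d \<bullet> G i \<omega>) \<and>
                 (\<forall>j\<in>I. j < i \<longrightarrow> G j \<omega> \<noteq> G i \<omega>)} \<in> sets N"
      using 1 2 unfolding pred_def by (intro sets.sets_Collect_conj)
  qed
qed

text \<open>
  Measurability must hold on the whole product space, including repeated and collinear points: the
  underlying probability spaces need not be complete, so an argument up to null sets would not do.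
\<close>

lemma measurable_chain_vertex_number:
  fixes I :: "nat set"
  assumes "finite I"
  shows "Measurable.pred (Pi\<^sub>M I (\<lambda>_. borel)) (\<lambda>x. f0 (convex hull ({(1,0),(0,1)} \<union> x ` I)) = k)"
proof -
  define G :: "nat \<Rightarrow> (nat \<Rightarrow> real \<times> real) \<Rightarrow> real \<times> real" where
    "G = (\<lambda>i x. if i = 0 then (1,0) else if i = 1 then (0,1) else x (i - 2))"
  define J where "J = {0,1} \<union> (\<lambda>i. i + 2) ` I"
  have "(\<lambda>x. real (f0 (convex hull ((\<lambda>i. G i x) ` J)))) \<in> borel_measurable (Pi\<^sub>M I (\<lambda>_. borel))"
  proof (rule measurable_vertex_number)
    show "finite J" using assms by (simp add: J_def)
    fix i assume "i \<in> J"
    then consider "i = 0" | "i = 1" | j where "i = j + 2" "j \<in> I" by (auto simp: J_def)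
    then show "G i \<in> borel_measurable (Pi\<^sub>M I (\<lambda>_. borel))"
      by cases (auto simp: G_def)
  qed
  moreover have "(\<lambda>i. G i x) ` J = {(1,0),(0,1)} \<union> x ` I" for x
    by (simp add: J_def image_Un image_image) (simp add: G_def)
  ultimately have [measurable]: "(\<lambda>x. real (f0 (convex hull ({(1,0),(0,1)} \<union> x ` I))))
       \<in> borel_measurable (Pi\<^sub>M I (\<lambda>_. borel))"
    by simp
  have "Measurable.pred (Pi\<^sub>M I (\<lambda>_. borel)) (\<lambda>x. real (f0 (convex hull ({(1,0),(0,1)} \<union> x ` I))) = real k)"
    by measurable
  then show ?thesis by simp
qed

section \<open>The uniform distribution on the triangle\<close>

abbreviation unif_T :: "(real \<times> real) measure" where
  "unif_T \<equiv> uniform_measure lborel T"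

lemma borel_measurable_fst_pair [measurable]: "(fst :: real \<times> real \<Rightarrow> real) \<in> borel_measurable borel"
  and borel_measurable_snd_pair [measurable]: "(snd :: real \<times> real \<Rightarrow> real) \<in> borel_measurable borel"
  by (intro borel_measurable_continuous_onI continuous_intros)+

lemma measurable_T [measurable]: "T \<in> sets borel"
  unfolding T_eq by measurable

lemma nn_integral_lborel_pair:
  fixes f :: "real \<times> real \<Rightarrow> ennreal"
  assumes [measurable]: "f \<in> borel_measurable borel"
  shows "(\<integral>\<^sup>+x. f x \<partial>lborel) = (\<integral>\<^sup>+p. \<integral>\<^sup>+r. f (p, r) \<partial>lborel \<partial>lborel)"
  by (subst lborel_prod[symmetric], subst lborel.nn_integral_fst[symmetric])
    (simp_all add: lborel_prod)

lemma indicator_T_slice: "indicator T (p, r) = indicator {0..1} p * (indicator {0..1-p} r :: ennreal)"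
  by (auto simp: T_eq indicator_def)

lemma nn_integral_power_diff:
  fixes c :: real
  assumes "0 \<le> c"
  shows "(\<integral>\<^sup>+r. ennreal ((c - r) ^ n) * indicator {0..c} r \<partial>lborel) = ennreal (c ^ Suc n / Suc n)"
proof -
  have "(\<integral>\<^sup>+r. ennreal ((c - r) ^ n) * indicator {0..c} r \<partial>lborel) =
      ennreal ((- ((c - c) ^ Suc n / Suc n)) - (- ((c - 0) ^ Suc n / Suc n)))"
  proof (rule nn_integral_FTC_Icc)
    fix x :: real
    show "((\<lambda>r. - ((c - r) ^ Suc n / Suc n)) has_real_derivative (c - x) ^ n) (at x)"
      by (auto intro!: derivative_eq_intros simp del: power_Suc of_nat_Suc)
  qed (use assms in auto)
  then show ?thesis by simp
qed

lemma emeasure_T: "emeasure lborel T = ennreal (1/2)"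
proof -
  have "emeasure lborel T = (\<integral>\<^sup>+x. indicator T x \<partial>lborel)" by simp
  also have "\<dots> = (\<integral>\<^sup>+p. \<integral>\<^sup>+r. indicator T (p, r) \<partial>lborel \<partial>lborel)"
    by (rule nn_integral_lborel_pair) simp
  also have "\<dots> = (\<integral>\<^sup>+p. ennreal ((1 - p) ^ 1) * indicator {0..1} p \<partial>lborel)"
  proof (rule nn_integral_cong)
    fix p :: real
    show "(\<integral>\<^sup>+r. indicator T (p, r) \<partial>lborel) = ennreal ((1 - p) ^ 1) * indicator {0..1} p"
      by (cases "p \<in> {0..1}") (simp_all add: indicator_T_slice nn_integral_cmult)
  qed
  also have "\<dots> = ennreal (1/2)" by (subst nn_integral_power_diff) auto
  finally show ?thesis .
qed

lemma nn_integral_unif_T: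
  assumes [measurable]: "f \<in> borel_measurable borel"
  shows "(\<integral>\<^sup>+x. f x \<partial>unif_T) = 2 * (\<integral>\<^sup>+p. \<integral>\<^sup>+r. f (p, r) * indicator T (p, r) \<partial>lborel \<partial>lborel)"
proof -
  have "(\<integral>\<^sup>+x. f x \<partial>unif_T) = (\<integral>\<^sup>+x. f x * indicator T x \<partial>lborel) / ennreal (1/2)"
    by (subst nn_integral_uniform_measure) (auto simp: emeasure_T)
  also have "\<dots> = 2 * (\<integral>\<^sup>+x. f x * indicator T x \<partial>lborel)"
  proof -
    have "inverse (ennreal (1/2)) = 2" by (subst inverse_ennreal) auto
    then show ?thesis by (simp add: divide_ennreal_def mult.commute)
  qed
  also have "(\<integral>\<^sup>+x. f x * indicator T x \<partial>lborel) = (\<integral>\<^sup>+p. \<integral>\<^sup>+r. f (p, r) * indicator T (p, r) \<partial>lborel \<partial>lborel)"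
    by (rule nn_integral_lborel_pair) measurable
  finally show ?thesis .
qed

lemma prob_space_unif_T: "prob_space unif_T"
  by (rule prob_space_uniform_measure) (auto simp: emeasure_T)

lemma sets_unif_T: "sets unif_T = sets borel" by simp

lemma AE_unif_T_in_T: "AE x in unif_T. x \<in> T"
  by (rule AE_uniform_measureI) auto

lemma AE_unif_T_line:
  assumes "a \<noteq> 0 \<or> b \<noteq> 0"
  shows "AE x in unif_T. a * fst x + b * snd x \<noteq> d"
proof -
  have "negligible {x. (a, b) \<bullet> x = d}"
    by (rule negligible_hyperplane) (use assms in \<open>auto simp: zero_prod_def\<close>)
  then have "{x. (a, b) \<bullet> x = d} \<in> null_sets lebesgue" by (simp add: negligible_iff_null_sets)
  moreover have "{x. (a, b) \<bullet> x = d} \<in> sets lborel" by simp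
  ultimately have "{x. (a, b) \<bullet> x = d} \<in> null_sets lborel"
    using null_sets_completion_iff by blast
  then have "AE x in lborel. x \<notin> {x. (a, b) \<bullet> x = d}" by (rule AE_not_in)
  then have "AE x in lborel. a * fst x + b * snd x \<noteq> d"
    by eventually_elim (auto simp: inner_prod_def)
  then show ?thesis by (intro AE_uniform_measureI) auto
qed

definition in_open_T :: "real \<times> real \<Rightarrow> bool" where
  "in_open_T y \<longleftrightarrow> y \<in> T \<and> 0 < fst y \<and> 0 < snd y \<and> fst y + snd y < 1"

lemma AE_in_open_T: "AE y in unif_T. in_open_T y"
proof -
  have "AE y in unif_T. 1 * fst y + 0 * snd y \<noteq> 0" "AE y in unif_T. 0 * fst y + 1 * snd y \<noteq> 0"
     "AE y in unif_T. 1 * fst y + 1 * snd y \<noteq> 1"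
    by (rule AE_unif_T_line; simp)+
  with AE_unif_T_in_T show ?thesis
    by eventually_elim (auto simp: in_open_T_def T_eq)
qed

lemma measurable_cap_map [measurable]: "cap_map y \<in> borel_measurable borel"
  unfolding cap_map_def by (simp add: borel_prod[symmetric])

text \<open>
  The share of the area of T taken by the triangle that \<open>cap_map y\<close> maps onto T.
\<close>

definition cap_share :: "real \<times> real \<Rightarrow> real" where
  "cap_share y = fst y * (1 - fst y - snd y) / (1 - fst y)"

text \<open>
  The share of the area of T taken by the triangle (1,0), y, (0,1).
\<close>

definition rest_share :: "real \<times> real \<Rightarrow> real" where
  "rest_share y = 1 - fst y - snd y"

lemma AE_snd_cap_map_nonzero:
  assumes "in_open_T y"
  shows "AE x in unif_T. snd (cap_map y x) \<noteq> 0"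
proof -
  have "AE x in unif_T. snd y * fst x + (1 - fst y) * snd x \<noteq> snd y"
    by (rule AE_unif_T_line) (use assms in \<open>auto simp: in_open_T_def\<close>)
  then show ?thesis
    by eventually_elim (use assms in \<open>auto simp: in_open_T_def cap_map_def algebra_simps\<close>)
qed

text \<open>
  The preimage of T is a triangle with its vertices in T, so it is contained in T. The proof writes the
  coordinates of x as the corresponding convex combination.
\<close>

lemma cap_map_in_T_imp:
  assumes y: "in_open_T y" and x: "cap_map y x \<in> T"
  shows "x \<in> T"
proof -
  define l s D where "l = fst y" and "s = snd y" and "D = 1 - fst y - snd y"
  have D: "D > 0" and l: "l > 0" "l < 1" and s: "s \<ge> 0" and Dls: "D = 1 - l - s"
    using y by (auto simp: D_def l_def s_def in_open_T_def)
  obtain p r where pr: "x = (p, r)" by (cases x)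
  define a e where "a = p / l" and "e = (r * (1 - l) - s * (1 - p)) / D"
  have "cap_map y x = (a, e)" by (simp add: cap_map_def pr a_def e_def l_def s_def D_def)
  then have ae: "0 \<le> a" "0 \<le> e" "a + e \<le> 1" using x by (auto simp: T_eq)
  have p: "p = a * l" using l by (simp add: a_def)
  have "r * (1 - l) = e * D + s * (1 - p)" using D by (simp add: e_def)
  then have r: "r * (1 - l) = e * D + s * (1 - a * l)" by (simp add: p)
  have "a * l \<le> 1" using ae l mult_mono[of a 1 l 1] by auto
  then have "0 \<le> r * (1 - l)" unfolding r using ae D s by simp
  then have "0 \<le> r" using l by (simp add: zero_le_mult_iff)
  moreover have "0 \<le> p" using ae l by (simp add: p)
  moreover have "p + r \<le> 1"
  proof -
    have "(p + r) * (1 - l) = a * l * (1 - l) + e * D + s * (1 - a * l)"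
      by (simp add: p distrib_right r[unfolded p])
    also have "\<dots> = (a * l) * D + e * D + s" by (simp add: Dls algebra_simps)
    also have "\<dots> \<le> a * D + e * D + s" using ae l D
      by (intro add_right_mono mult_right_mono mult_left_le) auto
    also have "\<dots> = (a + e) * D + s" by (simp add: algebra_simps)
    also have "\<dots> \<le> 1 * D + s" using ae D by (intro add_right_mono mult_right_mono) auto
    also have "\<dots> = 1 * (1 - l)" by (simp add: Dls)
    finally show ?thesis using l by (simp del: mult_1)
  qed
  ultimately show ?thesis by (simp add: T_eq pr)
qed

text \<open>
  An affine map takes the uniform distribution on a triangle to the uniform distribution on its image.
  Integrating first over the second coordinate, the map is affine in one variable at a time, so two
  one-dimensional substitutions suffice.
\<close>

lemma nn_integral_cap_map:
  assumes y: "in_open_T y" and f[measurable]: "f \<in> borel_measurable borel"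
  shows "(\<integral>\<^sup>+x. f (cap_map y x) * indicator {x \<in> T. 0 < snd (cap_map y x) \<and> cap_map y x \<in> T} x \<partial>unif_T)
       = ennreal (cap_share y) * (\<integral>\<^sup>+x. f x \<partial>unif_T)"
proof -
  define l s D where "l = fst y" and "s = snd y" and "D = 1 - fst y - snd y"
  have D: "D > 0" and l: "l > 0" "l < 1" and s: "s \<ge> 0" and Dls: "D = 1 - l - s"
    using y by (auto simp: D_def l_def s_def in_open_T_def)
  define F where "F = (\<lambda>z. f z * indicator {z \<in> T. 0 < snd z} z)"
  have [measurable]: "F \<in> borel_measurable borel" unfolding F_def by measurable
  have cap: "cap_map y (p, r) = (p / l, - (s * (1 - p) / D) + (1 - l) / D * r)" for p r
  proof -
    have "(r * (1 - l) - s * (1 - p)) / D = - (s * (1 - p) / D) + (1 - l) / D * r"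
      using D by (simp add: field_simps)
    then show ?thesis by (simp add: cap_map_def l_def s_def D_def)
  qed
  have "(\<integral>\<^sup>+x. f (cap_map y x) * indicator {x \<in> T. 0 < snd (cap_map y x) \<and> cap_map y x \<in> T} x \<partial>unif_T)
      = 2 * (\<integral>\<^sup>+p. \<integral>\<^sup>+r. F (cap_map y (p, r)) \<partial>lborel \<partial>lborel)"
    by (subst nn_integral_unif_T, measurable)
      (auto intro!: arg_cong[of _ _ "(*) 2"] nn_integral_cong simp: F_def indicator_def
        dest: cap_map_in_T_imp[OF y])
  also have "(\<integral>\<^sup>+p. \<integral>\<^sup>+r. F (cap_map y (p, r)) \<partial>lborel \<partial>lborel) =
     (\<integral>\<^sup>+p. ennreal (D / (1 - l)) * (\<integral>\<^sup>+r. F (p / l, r) \<partial>lborel) \<partial>lborel)"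
  proof (rule nn_integral_cong)
    fix p :: real
    have [measurable]: "(\<lambda>r. F (p / l, r)) \<in> borel_measurable borel" by measurable
    have "(\<integral>\<^sup>+r. F (p / l, r) \<partial>lborel) = ennreal \<bar>(1 - l) / D\<bar> *
        (\<integral>\<^sup>+r. F (p / l, - (s * (1 - p) / D) + (1 - l) / D * r) \<partial>lborel)"
      by (rule nn_integral_real_affine) (use D l in auto)
    then have "ennreal (D / (1 - l)) * (\<integral>\<^sup>+r. F (p / l, r) \<partial>lborel) =
       (ennreal (D / (1 - l)) * ennreal ((1 - l) / D)) * (\<integral>\<^sup>+r. F (p / l, - (s * (1 - p) / D) + (1 - l) / D * r) \<partial>lborel)"
      using D l by (simp add: mult.assoc)
    also have "ennreal (D / (1 - l)) * ennreal ((1 - l) / D) = 1"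
      using D l by (simp add: ennreal_mult[symmetric])
    finally show "(\<integral>\<^sup>+r. F (cap_map y (p, r)) \<partial>lborel) = ennreal (D / (1 - l)) * (\<integral>\<^sup>+r. F (p / l, r) \<partial>lborel)"
      by (simp add: cap)
  qed
  also have "\<dots> = ennreal (D / (1 - l)) * (\<integral>\<^sup>+p. (\<integral>\<^sup>+r. F (p / l, r) \<partial>lborel) \<partial>lborel)"
    by (rule nn_integral_cmult) measurable
  also have "(\<integral>\<^sup>+p. (\<integral>\<^sup>+r. F (p / l, r) \<partial>lborel) \<partial>lborel) = ennreal l * (\<integral>\<^sup>+p. (\<integral>\<^sup>+r. F (p, r) \<partial>lborel) \<partial>lborel)"
  proof -
    have "(\<integral>\<^sup>+p. (\<integral>\<^sup>+r. F (p, r) \<partial>lborel) \<partial>lborel) = ennreal \<bar>1 / l\<bar> * (\<integral>\<^sup>+p. (\<integral>\<^sup>+r. F (0 + 1 / l * p, r) \<partial>lborel) \<partial>lborel)"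
      by (rule nn_integral_real_affine) (use l in \<open>auto\<close>)
    then have "ennreal l * (\<integral>\<^sup>+p. (\<integral>\<^sup>+r. F (p, r) \<partial>lborel) \<partial>lborel) = (ennreal l * ennreal (1 / l)) * (\<integral>\<^sup>+p. (\<integral>\<^sup>+r. F (p / l, r) \<partial>lborel) \<partial>lborel)"
      using l by (simp add: mult.assoc)
    also have "ennreal l * ennreal (1 / l) = 1" using l by (simp add: ennreal_mult[symmetric])
    finally show ?thesis by simp
  qed
  also have "2 * (ennreal (D / (1 - l)) * (ennreal l * (\<integral>\<^sup>+p. (\<integral>\<^sup>+r. F (p, r) \<partial>lborel) \<partial>lborel))) =
     (ennreal (D / (1 - l)) * ennreal l) * (2 * (\<integral>\<^sup>+p. (\<integral>\<^sup>+r. F (p, r) \<partial>lborel) \<partial>lborel))"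
    by (simp add: ac_simps)
  also have "ennreal (D / (1 - l)) * ennreal l = ennreal (cap_share y)"
    using D l by (simp add: ennreal_mult[symmetric] cap_share_def D_def l_def mult.commute)
  also have "2 * (\<integral>\<^sup>+p. (\<integral>\<^sup>+r. F (p, r) \<partial>lborel) \<partial>lborel) = (\<integral>\<^sup>+x. F x \<partial>unif_T)"
    by (subst nn_integral_unif_T) (auto intro!: arg_cong[of _ _ "(*) 2"] nn_integral_cong simp: F_def indicator_def)
  also have "(\<integral>\<^sup>+x. F x \<partial>unif_T) = (\<integral>\<^sup>+x. f x \<partial>unif_T)"
  proof (rule nn_integral_cong_AE)
    show "AE x in unif_T. F x = f x"
      using AE_in_open_T by eventually_elim (auto simp: F_def in_open_T_def)
  qed
  finally show ?thesis .
qed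

lemma emeasure_above:
  assumes y: "in_open_T y"
  shows "emeasure unif_T {x \<in> T. 0 < snd (cap_map y x)} = ennreal (rest_share y / (1 - fst y))"
proof -
  define l s D where "l = fst y" and "s = snd y" and "D = 1 - fst y - snd y"
  have D: "D > 0" and l: "l > 0" "l < 1" and s: "s \<ge> 0" and Dls: "D = 1 - l - s"
    using y by (auto simp: D_def l_def s_def in_open_T_def)
  define t where "t = s / (1 - l)"
  have t: "0 \<le> t" "t < 1" using l s D by (auto simp: t_def Dls)
  have above: "0 < snd (cap_map y (p, r)) \<longleftrightarrow> t * (1 - p) < r" for p r
  proof -
    have "0 < snd (cap_map y (p, r)) \<longleftrightarrow> s * (1 - p) < r * (1 - l)"
      using D by (simp add: cap_map_def D_def l_def s_def zero_less_divide_iff)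
    also have "\<dots> \<longleftrightarrow> s * (1 - p) / (1 - l) < r" using l by (simp add: pos_divide_less_eq)
    finally show ?thesis by (simp add: t_def)
  qed
  have "emeasure unif_T {x \<in> T. 0 < snd (cap_map y x)} = (\<integral>\<^sup>+x. indicator {x \<in> T. 0 < snd (cap_map y x)} x \<partial>unif_T)"
    by simp
  also have "\<dots> = 2 * (\<integral>\<^sup>+p. \<integral>\<^sup>+r. indicator {x \<in> T. 0 < snd (cap_map y x)} (p, r) * indicator T (p, r) \<partial>lborel \<partial>lborel)"
    by (rule nn_integral_unif_T) measurable
  also have "\<dots> = 2 * (\<integral>\<^sup>+p. ennreal (1 - t) * (ennreal ((1 - p) ^ 1) * indicator {0..1} p) \<partial>lborel)"
  proof (intro arg_cong[of _ _ "(*) 2"] nn_integral_cong)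
    fix p :: real
    show "(\<integral>\<^sup>+r. indicator {x \<in> T. 0 < snd (cap_map y x)} (p, r) * indicator T (p, r) \<partial>lborel) =
       ennreal (1 - t) * (ennreal ((1 - p) ^ 1) * indicator {0..1} p)"
    proof (cases "p \<in> {0..1}")
      case True
      then have tp: "0 \<le> t * (1 - p)" "t * (1 - p) \<le> 1 - p" using t by (auto simp: mult_left_le_one_le)
      have "(\<integral>\<^sup>+r. indicator {x \<in> T. 0 < snd (cap_map y x)} (p, r) * indicator T (p, r) \<partial>lborel) =
         (\<integral>\<^sup>+r. indicator {t * (1 - p)<..1 - p} r \<partial>lborel)"
        using True tp by (intro nn_integral_cong) (auto simp: indicator_def above T_eq)
      also have "\<dots> = ennreal ((1 - t) * (1 - p))" using tp by (simp add: algebra_simps)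
      finally show ?thesis using True t by (simp add: ennreal_mult)
    next
      case False
      then have "(p, r) \<notin> T" for r by (auto simp: T_eq)
      with False show ?thesis by simp
    qed
  qed
  also have "(\<integral>\<^sup>+p. ennreal (1 - t) * (ennreal ((1 - p) ^ 1) * indicator {0..1} p) \<partial>lborel) =
      ennreal (1 - t) * (\<integral>\<^sup>+p. (ennreal ((1 - p) ^ 1) * indicator {0..1} p) \<partial>lborel)"
    by (rule nn_integral_cmult) measurable
  also have "(\<integral>\<^sup>+p. (ennreal ((1 - p) ^ 1) * indicator {0..1} p) \<partial>lborel) = ennreal (1 / 2)"
    by (subst nn_integral_power_diff) auto
  also have "2 * (ennreal (1 - t) * ennreal (1 / 2)) = ennreal (1 - t)"
  proof -
    have "ennreal (1 - t) * ennreal (1 / 2) = ennreal ((1 - t) * (1 / 2))"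
      by (rule ennreal_mult[symmetric]) (use t in auto)
    moreover have "ennreal 2 * ennreal ((1 - t) * (1 / 2)) = ennreal (2 * ((1 - t) * (1 / 2)))"
      by (rule ennreal_mult[symmetric]) (use t in auto)
    moreover have "2 * ((1 - t) * (1 / 2)) = 1 - t" by (simp add: field_simps)
    ultimately show ?thesis by (simp only: ennreal_numeral)
  qed
  also have "1 - t = rest_share y / (1 - fst y)"
    using l by (simp add: t_def rest_share_def l_def s_def field_simps)
  finally show ?thesis .
qed

text \<open>
  Both triangles together make up the part of T above the line, whose share is
  \<open>rest_share y / (1 - fst y)\<close>.
\<close>

lemma emeasure_rest:
  assumes y: "in_open_T y"
  shows "emeasure unif_T {x \<in> T. 0 < snd (cap_map y x) \<and> cap_map y x \<notin> T} = ennreal (rest_share y)"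
proof -
  interpret prob_space unif_T by (rule prob_space_unif_T)
  have yy: "0 < fst y" "fst y < 1" "0 < rest_share y" using y by (auto simp: in_open_T_def rest_share_def)
  let ?B = "{x \<in> T. 0 < snd (cap_map y x) \<and> cap_map y x \<in> T}"
  let ?U = "{x \<in> T. 0 < snd (cap_map y x)}"
  have [measurable]: "?B \<in> sets borel" "?U \<in> sets borel" by measurable
  have B: "emeasure unif_T ?B = ennreal (cap_share y)"
    using nn_integral_cap_map[OF y, of "\<lambda>_. 1"] emeasure_space_1 by simp
  have "{x \<in> T. 0 < snd (cap_map y x) \<and> cap_map y x \<notin> T} = ?U - ?B" by auto
  also have "emeasure unif_T (?U - ?B) = emeasure unif_T ?U - emeasure unif_T ?B"
    by (rule emeasure_Diff) (auto simp: B)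
  also have "\<dots> = ennreal (rest_share y / (1 - fst y) - cap_share y)"
    unfolding B emeasure_above[OF y]
    by (rule ennreal_minus) (use yy in \<open>simp add: cap_share_def rest_share_def\<close>)
  also have "rest_share y / (1 - fst y) - cap_share y = rest_share y"
    using yy by (simp add: cap_share_def rest_share_def[symmetric] diff_divide_distrib[symmetric])
      (simp add: field_simps)
  finally show ?thesis .
qed

section \<open>Independent uniform points\<close>

interpretation unif_T: prob_space unif_T by (rule prob_space_unif_T)

interpretation unif_T_prod: product_prob_space "\<lambda>_::nat. unif_T" UNIV
  by unfold_locales

abbreviation unif_Ts :: "nat set \<Rightarrow> (nat \<Rightarrow> real \<times> real) measure" where
  "unif_Ts I \<equiv> Pi\<^sub>M I (\<lambda>_. unif_T)"

lemma sets_unif_Ts: "sets (unif_Ts I) = sets (Pi\<^sub>M I (\<lambda>_. borel))"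
  by (rule sets_PiM_cong) auto

lemma nn_integral_unif_Ts_push:
  assumes A[measurable]: "A \<in> borel_measurable borel" and B[measurable]: "B \<in> sets borel"
    and push: "\<And>f. f \<in> borel_measurable borel \<Longrightarrow>
       (\<integral>\<^sup>+x. f (A x) * indicator B x \<partial>unif_T) = b * (\<integral>\<^sup>+x. f x \<partial>unif_T)"
    and "finite J" "H \<in> borel_measurable (unif_Ts J)"
  shows "(\<integral>\<^sup>+x. H (\<lambda>i\<in>J. A (x i)) * (\<Prod>i\<in>J. indicator B (x i)) \<partial>unif_Ts J)
       = b ^ card J * (\<integral>\<^sup>+x. H x \<partial>unif_Ts J)"
  using \<open>finite J\<close> \<open>H \<in> _\<close>
proof (induction J arbitrary: H)
  case empty
  then show ?case by (simp add: space_PiM nn_integral_count_space_finite PiM_empty restrict_def)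
next
  case (insert i J)
  note [measurable] = insert.prems
  have [measurable]: "(\<lambda>x. x(i := z)) \<in> measurable (unif_Ts J) (unif_Ts (insert i J))" for z
    by (rule measurable_fun_upd[where J = J]) auto
  interpret J: prob_space "unif_Ts J"
    by (rule prob_space_PiM) (rule prob_space_unif_T)
  have "(\<lambda>y. \<integral>\<^sup>+x. H (x(i := y)) \<partial>unif_Ts J) \<in> borel_measurable unif_T"
    by (rule J.borel_measurable_nn_integral) measurable
  then have [measurable]: "(\<lambda>y. \<integral>\<^sup>+x. H (x(i := y)) \<partial>unif_Ts J) \<in> borel_measurable borel"
    by simp
  have upd: "(\<lambda>k\<in>insert i J. A ((x(i := y)) k)) = (\<lambda>k\<in>J. A (x k))(i := A y)" for x y
    using insert.hyps by (auto simp: fun_eq_iff)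
  have pr: "(\<Prod>k\<in>insert i J. indicator B ((x(i := y)) k)) = indicator B y * (\<Prod>k\<in>J. indicator B (x k) :: ennreal)" for x y
    using insert.hyps by (simp, intro prod.cong arg_cong2[of _ _ _ _ "(*)"]) auto
  have [measurable]: "(\<lambda>x. \<lambda>i\<in>J. A (x i)) \<in> measurable (unif_Ts J) (unif_Ts J)"
    by (rule measurable_restrict) simp
  have [measurable]: "(\<lambda>x. \<lambda>k\<in>insert i J. A (x k)) \<in> measurable (unif_Ts (insert i J)) (unif_Ts (insert i J))"
    by (rule measurable_restrict) simp
  have "(\<integral>\<^sup>+x. H (\<lambda>k\<in>insert i J. A (x k)) * (\<Prod>k\<in>insert i J. indicator B (x k)) \<partial>unif_Ts (insert i J)) =
     (\<integral>\<^sup>+y. (\<integral>\<^sup>+x. H ((\<lambda>k\<in>J. A (x k))(i := A y)) * (\<Prod>k\<in>J. indicator B (x k)) * indicator B y \<partial>unif_Ts J) \<partial>unif_T)"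
    using insert.hyps
    by (subst unif_T_prod.product_nn_integral_insert_rev) (auto simp: upd pr simp del: prod.insert fun_upd_apply simp: ac_simps)
  also have "\<dots> = (\<integral>\<^sup>+y. (b ^ card J * (\<integral>\<^sup>+x. H (x(i := A y)) \<partial>unif_Ts J)) * indicator B y \<partial>unif_T)"
  proof (rule nn_integral_cong)
    fix y
    have "(\<integral>\<^sup>+x. H ((\<lambda>k\<in>J. A (x k))(i := A y)) * (\<Prod>k\<in>J. indicator B (x k)) * indicator B y \<partial>unif_Ts J) =
      (\<integral>\<^sup>+x. H ((\<lambda>k\<in>J. A (x k))(i := A y)) * (\<Prod>k\<in>J. indicator B (x k)) \<partial>unif_Ts J) * indicator B y"
      by (rule nn_integral_multc) measurable
    also have "(\<integral>\<^sup>+x. H ((\<lambda>k\<in>J. A (x k))(i := A y)) * (\<Prod>k\<in>J. indicator B (x k)) \<partial>unif_Ts J) =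
      b ^ card J * (\<integral>\<^sup>+x. H (x(i := A y)) \<partial>unif_Ts J)"
      by (rule insert.IH) measurable
    finally show "(\<integral>\<^sup>+x. H ((\<lambda>k\<in>J. A (x k))(i := A y)) * (\<Prod>k\<in>J. indicator B (x k)) * indicator B y \<partial>unif_Ts J) =
       b ^ card J * (\<integral>\<^sup>+x. H (x(i := A y)) \<partial>unif_Ts J) * indicator B y" .
  qed
  also have "\<dots> = b * (\<integral>\<^sup>+y. (b ^ card J * (\<integral>\<^sup>+x. H (x(i := y)) \<partial>unif_Ts J)) \<partial>unif_T)"
    by (rule push) measurable
  also have "\<dots> = b * (b ^ card J * (\<integral>\<^sup>+y. (\<integral>\<^sup>+x. H (x(i := y)) \<partial>unif_Ts J) \<partial>unif_T))"
    by (subst nn_integral_cmult) measurable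
  also have "(\<integral>\<^sup>+y. (\<integral>\<^sup>+x. H (x(i := y)) \<partial>unif_Ts J) \<partial>unif_T) = (\<integral>\<^sup>+x. H x \<partial>unif_Ts (insert i J))"
    using insert.hyps by (subst unif_T_prod.product_nn_integral_insert_rev) auto
  finally show ?case using insert.hyps by (simp add: mult.assoc)
qed

text \<open>
  The points with index in J fall into B and the others into C. In the application b is the share of
  B, and A takes the points in B to uniform points, so that these are, after conditioning, again
  independent and uniform.
\<close>

lemma nn_integral_unif_Ts_push_subset:
  assumes A[measurable]: "A \<in> borel_measurable borel"
    and B[measurable]: "B \<in> sets borel" and C[measurable]: "C \<in> sets borel"
    and push: "\<And>f. f \<in> borel_measurable borel \<Longrightarrow>
       (\<integral>\<^sup>+x. f (A x) * indicator B x \<partial>unif_T) = b * (\<integral>\<^sup>+x. f x \<partial>unif_T)"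
    and "finite I" "J \<subseteq> I" and H[measurable]: "H \<in> borel_measurable (unif_Ts J)"
  shows "(\<integral>\<^sup>+x. H (\<lambda>i\<in>J. A (x i)) * (\<Prod>i\<in>J. indicator B (x i)) * (\<Prod>i\<in>I-J. indicator C (x i)) \<partial>unif_Ts I)
       = b ^ card J * emeasure unif_T C ^ (card I - card J) * (\<integral>\<^sup>+x. H x \<partial>unif_Ts J)"
proof -
  define L where "L = I - J"
  have I: "I = J \<union> L" "J \<inter> L = {}" "finite J" "finite L" "card L = card I - card J"
    using assms by (auto simp: L_def finite_subset card_Diff_subset)
  have [measurable]: "(\<lambda>x. \<lambda>i\<in>J. A (x i)) \<in> measurable (unif_Ts (J \<union> L)) (unif_Ts J)"
     "(\<lambda>x. \<lambda>i\<in>J. A (x i)) \<in> measurable (unif_Ts J) (unif_Ts J)"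
    by (rule measurable_restrict; simp)+
  define F where "F = (\<lambda>x. H (\<lambda>i\<in>J. A (x i)) * (\<Prod>i\<in>J. indicator B (x i)) * (\<Prod>i\<in>L. indicator C (x i)))"
  have [measurable]: "F \<in> borel_measurable (unif_Ts (J \<union> L))"
    unfolding F_def by measurable
  have "(\<integral>\<^sup>+x. F x \<partial>unif_Ts I) = (\<integral>\<^sup>+x. (\<integral>\<^sup>+y. F (merge J L (x, y)) \<partial>unif_Ts L) \<partial>unif_Ts J)"
    using I by (simp only: I(1)) (rule unif_T_prod.product_nn_integral_fold; simp)
  also have "\<dots> = (\<integral>\<^sup>+x. H (\<lambda>i\<in>J. A (x i)) * (\<Prod>i\<in>J. indicator B (x i)) * emeasure unif_T C ^ card L \<partial>unif_Ts J)"
  proof (rule nn_integral_cong)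
    fix x assume "x \<in> space (unif_Ts J)"
    have 1: "(\<lambda>i\<in>J. A (merge J L (x, y) i)) = (\<lambda>i\<in>J. A (x i))" for y
      by (auto simp: merge_def fun_eq_iff)
    have 2: "(\<Prod>i\<in>J. indicator B (merge J L (x, y) i)) = (\<Prod>i\<in>J. indicator B (x i) :: ennreal)" for y
      by (rule prod.cong) (auto simp: merge_def)
    have 3: "(\<Prod>i\<in>L. indicator C (merge J L (x, y) i)) = (\<Prod>i\<in>L. indicator C (y i) :: ennreal)" for y
      using I(2) by (intro prod.cong) (auto simp: merge_def)
    have "(\<integral>\<^sup>+y. F (merge J L (x, y)) \<partial>unif_Ts L) =
       (\<integral>\<^sup>+y. H (\<lambda>i\<in>J. A (x i)) * (\<Prod>i\<in>J. indicator B (x i)) * (\<Prod>i\<in>L. indicator C (y i)) \<partial>unif_Ts L)"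
      by (simp only: F_def 1 2 3)
    also have "\<dots> = H (\<lambda>i\<in>J. A (x i)) * (\<Prod>i\<in>J. indicator B (x i)) * (\<integral>\<^sup>+y. (\<Prod>i\<in>L. indicator C (y i)) \<partial>unif_Ts L)"
      by (rule nn_integral_cmult) measurable
    also have "(\<integral>\<^sup>+y. (\<Prod>i\<in>L. indicator C (y i)) \<partial>unif_Ts L) = emeasure unif_T C ^ card L"
      by (subst unif_T_prod.product_nn_integral_prod) (use I in auto)
    finally show "(\<integral>\<^sup>+y. F (merge J L (x, y)) \<partial>unif_Ts L) =
       H (\<lambda>i\<in>J. A (x i)) * (\<Prod>i\<in>J. indicator B (x i)) * emeasure unif_T C ^ card L" .
  qed
  also have "\<dots> = (\<integral>\<^sup>+x. H (\<lambda>i\<in>J. A (x i)) * (\<Prod>i\<in>J. indicator B (x i)) \<partial>unif_Ts J) * emeasure unif_T C ^ card L"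
    by (rule nn_integral_multc) measurable
  also have "(\<integral>\<^sup>+x. H (\<lambda>i\<in>J. A (x i)) * (\<Prod>i\<in>J. indicator B (x i)) \<partial>unif_Ts J) = b ^ card J * (\<integral>\<^sup>+x. H x \<partial>unif_Ts J)"
    by (rule nn_integral_unif_Ts_push[OF A B push I(3) H])
  finally show ?thesis by (simp add: F_def L_def I(5)[unfolded L_def] ac_simps)
qed

text \<open>
  Exactly one J contributes: the set of indices whose points lie in B.
\<close>

lemma sum_Pow_partition_indicator:
  fixes h :: "nat set \<Rightarrow> ennreal"
  assumes "finite I" "B \<inter> C = {}"
  shows "(\<Sum>J\<in>Pow I. h J * (\<Prod>i\<in>J. indicator B (x i)) * (\<Prod>i\<in>I-J. indicator C (x i))) =
         h {i\<in>I. x i \<in> B} * (\<Prod>i\<in>I. indicator (B \<union> C) (x i))"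
proof (cases "\<forall>i\<in>I. x i \<in> B \<union> C")
  case True
  let ?J = "{i\<in>I. x i \<in> B}"
  have "(\<Prod>i\<in>J. indicator B (x i)) * (\<Prod>i\<in>I-J. indicator C (x i)) = (if J = ?J then 1 else 0 :: ennreal)" if J: "J \<subseteq> I" for J
  proof (cases "J = ?J")
    case True
    then show ?thesis using \<open>\<forall>i\<in>I. x i \<in> B \<union> C\<close> by (auto simp: indicator_def intro!: prod.neutral)
  next
    case False
    have fin: "finite J" "finite (I - J)" using J assms finite_subset by auto
    from False J obtain i where "i \<in> J \<and> x i \<notin> B \<or> i \<in> I - J \<and> x i \<in> B" by blast
    then show ?thesis
    proof
      assume i: "i \<in> J \<and> x i \<notin> B"
      then have "(\<Prod>i\<in>J. indicator B (x i)) = (0::ennreal)" using fin by (intro prod_zero bexI[of _ i]) auto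
      then show ?thesis using False by simp
    next
      assume i: "i \<in> I - J \<and> x i \<in> B"
      then have "x i \<notin> C" using assms by auto
      with i have "(\<Prod>i\<in>I-J. indicator C (x i)) = (0::ennreal)" using fin by (intro prod_zero bexI[of _ i]) auto
      then show ?thesis using False by simp
    qed
  qed
  then have "(\<Sum>J\<in>Pow I. h J * (\<Prod>i\<in>J. indicator B (x i)) * (\<Prod>i\<in>I-J. indicator C (x i))) =
     (\<Sum>J\<in>Pow I. h J * (if J = ?J then 1 else 0))"
    by (intro sum.cong refl) (simp add: mult.assoc)
  also have "\<dots> = (\<Sum>J\<in>Pow I. (if J = ?J then h J else 0))" by (intro sum.cong) auto
  also have "\<dots> = h ?J" using assms by (subst sum.delta) auto
  finally show ?thesis using True by (simp add: indicator_def)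
next
  case False
  then obtain i where i: "i \<in> I" "x i \<notin> B" "x i \<notin> C" by auto
  have zero: "(\<Prod>i\<in>J. indicator B (x i)) * (\<Prod>i\<in>I-J. indicator C (x i)) = (0 :: ennreal)" if J: "J \<subseteq> I" for J
  proof -
    have fin: "finite J" "finite (I - J)" using J assms finite_subset by auto
    have "(\<Prod>i\<in>J. indicator B (x i)) = (0::ennreal) \<or> (\<Prod>i\<in>I-J. indicator C (x i)) = (0::ennreal)"
      by (cases "i \<in> J") (use i fin in \<open>auto intro!: prod_zero bexI[of _ i]\<close>)
    then show ?thesis by auto
  qed
  have "(\<Sum>J\<in>Pow I. h J * (\<Prod>i\<in>J. indicator B (x i)) * (\<Prod>i\<in>I-J. indicator C (x i))) = 0"
  proof (intro sum.neutral ballI)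
    fix J assume "J \<in> Pow I"
    then show "h J * (\<Prod>i\<in>J. indicator B (x i)) * (\<Prod>i\<in>I-J. indicator C (x i)) = 0"
      using zero[of J] by (simp only: mult.assoc Pow_iff mult_zero_right)
  qed
  moreover have "(\<Prod>i\<in>I. indicator (B \<union> C) (x i)) = (0 :: ennreal)"
    using assms i by (intro prod_zero bexI[of _ i]) auto
  ultimately show ?thesis by (simp only: mult_zero_right)
qed

section \<open>The law of the number of vertices\<close>

text \<open>
  The solution of Buchta's recursion, which turns out to be the probability that k of n random
  points are vertices.
\<close>

fun chain_prob :: "nat \<Rightarrow> nat \<Rightarrow> real" where
  "chain_prob 0 n = (if n = 0 then 1 else 0)"
| "chain_prob (Suc k) n = 2 / (real n * (real n + 1)) * (\<Sum>m<n. real (n - m) * chain_prob k m)"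

lemma chain_prob_nonneg: "0 \<le> chain_prob k n"
  by (induction k arbitrary: n) (auto intro!: mult_nonneg_nonneg sum_nonneg divide_nonneg_nonneg)

lemma Beta_integral_nat:
  "(\<integral>\<^sup>+t. ennreal (t ^ m * (1 - t) ^ n) * indicator {0..1} t \<partial>lborel) =
   ennreal (fact m * fact n / fact (m + n + 1))"
proof -
  have "((\<lambda>t. t powr (real (m + 1) - 1) * (1 - t) powr (real (n + 1) - 1)) has_integral
      Beta (real (m + 1)) (real (n + 1))) {0..1}"
    by (rule has_integral_Beta_real) auto
  then have "((\<lambda>t. t ^ m * (1 - t) ^ n) has_integral Beta (real (m + 1)) (real (n + 1))) {0..1}"
    by (rule has_integral_spike_finite[of "{0,1}", rotated 2]) (auto simp: powr_realpow)
  moreover have "Beta (real (m + 1)) (real (n + 1)) = fact m * fact n / fact (m + n + 1)"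
    using Gamma_fact[of m, where 'a = real] Gamma_fact[of n, where 'a = real]
      Gamma_fact[of "m + n + 1", where 'a = real]
    by (simp add: Beta_def add_ac)
  ultimately have "((\<lambda>t. t ^ m * (1 - t) ^ n) has_integral fact m * fact n / fact (m + n + 1)) {0..1::real}"
    by simp
  then have "(\<integral>\<^sup>+t\<in>{0..1}. ennreal (t ^ m * (1 - t) ^ n) \<partial>lborel) = ennreal (fact m * fact n / fact (m + n + 1))"
    by (intro nn_integral_has_integral_lebesgue') auto
  then show ?thesis by simp
qed

lemma sum_Pow_card:
  fixes g :: "nat \<Rightarrow> 'b::semiring_1"
  assumes "finite I"
  shows "(\<Sum>J\<in>Pow I. g (card J)) = (\<Sum>m\<le>card I. of_nat (card I choose m) * g m)"
proof -
  have "(\<Sum>J\<in>Pow I. g (card J)) = (\<Sum>m\<in>{..card I}. \<Sum>J\<in>{J\<in>Pow I. card J = m}. g (card J))"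
    by (rule sum.group[symmetric]) (use assms in \<open>auto intro: card_mono\<close>)
  also have "\<dots> = (\<Sum>m\<le>card I. of_nat (card I choose m) * g m)"
  proof (rule sum.cong)
    fix m assume "m \<in> {..card I}"
    have "(\<Sum>J\<in>{J\<in>Pow I. card J = m}. g (card J)) = (\<Sum>J\<in>{J\<in>Pow I. card J = m}. g m)"
      by (rule sum.cong) auto
    also have "\<dots> = of_nat (card {J\<in>Pow I. card J = m}) * g m" by simp
    also have "card {J\<in>Pow I. card J = m} = card I choose m"
      using n_subsets[OF assms, of m] by (simp add: Pow_def)
    finally show "(\<Sum>J\<in>{J\<in>Pow I. card J = m}. g (card J)) = of_nat (card I choose m) * g m" .
  qed simp
  finally show ?thesis .
qed

definition vertex_event :: "nat set \<Rightarrow> nat \<Rightarrow> (nat \<Rightarrow> real \<times> real) set" where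
  "vertex_event I k = {x \<in> space (unif_Ts I). f0 (convex hull ({(1,0),(0,1)} \<union> x ` I)) = k + 2}"

lemma measurable_vertex_event [measurable]:
  assumes "finite I"
  shows "vertex_event I k \<in> sets (unif_Ts I)"
proof -
  have "Measurable.pred (unif_Ts I) (\<lambda>x. f0 (convex hull ({(1,0),(0,1)} \<union> x ` I)) = k + 2)"
    using measurable_chain_vertex_number[OF assms]
    by (subst measurable_cong_sets[OF sets_unif_Ts refl])
  then show ?thesis unfolding vertex_event_def pred_def .
qed

lemma borel_measurable_cap_share [measurable]: "cap_share \<in> borel_measurable borel"
  and borel_measurable_rest_share [measurable]: "rest_share \<in> borel_measurable borel"
  unfolding cap_share_def rest_share_def by measurable

text \<open>
  For a fixed first coordinate p the integral over the second one is elementary and leaves the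
  Beta integrand \<open>p^m (1-p)^(N+1-m)\<close>.
\<close>

lemma nn_integral_shares:
  assumes "m \<le> N"
  shows "(\<integral>\<^sup>+y. ennreal (cap_share y ^ m * rest_share y ^ (N - m)) \<partial>unif_T) =
         ennreal (2 / (N + 1) * (fact m * fact (N + 1 - m) / fact (N + 2)))"
proof -
  have "(\<integral>\<^sup>+y. ennreal (cap_share y ^ m * rest_share y ^ (N - m)) \<partial>unif_T) =
    2 * (\<integral>\<^sup>+p. \<integral>\<^sup>+r. ennreal (cap_share (p, r) ^ m * rest_share (p, r) ^ (N - m)) * indicator T (p, r) \<partial>lborel \<partial>lborel)"
    by (rule nn_integral_unif_T) measurable
  also have "\<dots> = 2 * (\<integral>\<^sup>+p. ennreal (1 / (N + 1)) * (ennreal (p ^ m * (1 - p) ^ (N + 1 - m)) * indicator {0..1} p) \<partial>lborel)"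
  proof (intro arg_cong[of _ _ "(*) 2"] nn_integral_cong_AE)
    have "AE p in lborel. p \<noteq> (1::real)" by (rule AE_lborel_singleton)
    then show "AE p in lborel. (\<integral>\<^sup>+r. ennreal (cap_share (p, r) ^ m * rest_share (p, r) ^ (N - m)) * indicator T (p, r) \<partial>lborel) =
       ennreal (1 / (N + 1)) * (ennreal (p ^ m * (1 - p) ^ (N + 1 - m)) * indicator {0..1} p)"
    proof eventually_elim
      case (elim p)
      show ?case
      proof (cases "p \<in> {0..1}")
        case True
        then have p: "0 \<le> p" "p < 1" using elim by auto
        have "(\<integral>\<^sup>+r. ennreal (cap_share (p, r) ^ m * rest_share (p, r) ^ (N - m)) * indicator T (p, r) \<partial>lborel) =
          (\<integral>\<^sup>+r. ennreal ((p / (1 - p)) ^ m) * (ennreal ((1 - p - r) ^ N) * indicator {0..1-p} r) \<partial>lborel)"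
        proof (rule nn_integral_cong)
          fix r
          show "ennreal (cap_share (p, r) ^ m * rest_share (p, r) ^ (N - m)) * indicator T (p, r) =
            ennreal ((p / (1 - p)) ^ m) * (ennreal ((1 - p - r) ^ N) * indicator {0..1-p} r)"
          proof (cases "r \<in> {0..1-p}")
            case True
            have "(1 - p - r) ^ N = (1 - p - r) ^ m * (1 - p - r) ^ (N - m)"
              using assms by (simp add: power_add[symmetric])
            then have "cap_share (p, r) ^ m * rest_share (p, r) ^ (N - m) = (p / (1 - p)) ^ m * (1 - p - r) ^ N"
              by (simp add: cap_share_def rest_share_def power_mult_distrib power_divide)
            then show ?thesis using True p by (simp add: ennreal_mult indicator_T_slice)
          next
            case False
            then show ?thesis by (simp add: indicator_T_slice)
          qed
        qed
        also have "\<dots> = ennreal ((p / (1 - p)) ^ m) * ennreal ((1 - p) ^ Suc N / Suc N)"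
          using p by (subst nn_integral_cmult) (measurable, subst nn_integral_power_diff, auto)
        also have "\<dots> = ennreal ((p / (1 - p)) ^ m * ((1 - p) ^ Suc N / Suc N))"
          by (rule ennreal_mult[symmetric]) (use p in auto)
        also have "(p / (1 - p)) ^ m * ((1 - p) ^ Suc N / Suc N) = 1 / (N + 1) * (p ^ m * (1 - p) ^ (N + 1 - m))"
        proof -
          have "(1 - p) ^ Suc N = (1 - p) ^ m * (1 - p) ^ (N + 1 - m)"
            using assms by (simp add: power_add[symmetric] del: power_Suc)
          then show ?thesis using p by (simp add: power_divide del: power_Suc)
        qed
        also have "ennreal (1 / (N + 1) * (p ^ m * (1 - p) ^ (N + 1 - m))) =
            ennreal (1 / (N + 1)) * ennreal (p ^ m * (1 - p) ^ (N + 1 - m))"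
          by (rule ennreal_mult) (use p in auto)
        finally show ?thesis using True by simp
      qed (simp add: indicator_T_slice)
    qed
  qed
  also have "(\<integral>\<^sup>+p. ennreal (1 / (N + 1)) * (ennreal (p ^ m * (1 - p) ^ (N + 1 - m)) * indicator {0..1} p) \<partial>lborel)
     = ennreal (1 / (N + 1)) * ennreal (fact m * fact (N + 1 - m) / fact (N + 2))"
    using assms by (subst nn_integral_cmult) (measurable, subst Beta_integral_nat, simp)
  also have "2 * (ennreal (1 / (N + 1)) * ennreal (fact m * fact (N + 1 - m) / fact (N + 2))) =
    ennreal 2 * ennreal (1 / (N + 1) * (fact m * fact (N + 1 - m) / fact (N + 2)))"
    by (subst ennreal_mult) auto
  also have "\<dots> = ennreal (2 * (1 / (N + 1) * (fact m * fact (N + 1 - m) / fact (N + 2))))"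
    by (rule ennreal_mult[symmetric]) auto
  finally show ?thesis by simp
qed

text \<open>
  Up to sign the slope of the line through (1,0) and x, so points with smaller slope are seen from
  (1,0) under a smaller angle.
\<close>

definition slope :: "real \<times> real \<Rightarrow> real" where
  "slope x = snd x / (1 - fst x)"

text \<open>
  The point with index j is the neighbour of (1,0) on the chain: all others lie strictly above the line
  through (1,0) and it.
\<close>

definition first_event :: "nat set \<Rightarrow> nat \<Rightarrow> (nat \<Rightarrow> real \<times> real) set" where
  "first_event I j = {x \<in> space (unif_Ts I). \<forall>i\<in>I - {j}. x i \<in> T \<and>
      0 < snd (cap_map (x j) (x i))}"

lemma snd_cap_map_pos_iff:
  assumes "in_open_T y" "fst x < 1"
  shows "0 < snd (cap_map y x) \<longleftrightarrow> slope y < slope x"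
proof -
  have "0 < snd (cap_map y x) \<longleftrightarrow> snd y * (1 - fst x) < snd x * (1 - fst y)"
    using assms by (simp add: cap_map_def in_open_T_def zero_less_divide_iff)
  also have "\<dots> \<longleftrightarrow> slope y < slope x"
    using assms by (simp add: slope_def in_open_T_def divide_less_eq less_divide_eq field_simps)
  finally show ?thesis .
qed

lemma measurable_cap_map_pair [measurable]:
  assumes [measurable]: "f \<in> borel_measurable M" "g \<in> borel_measurable M"
  shows "(\<lambda>x. cap_map (f x) (g x)) \<in> borel_measurable M"
  unfolding cap_map_def by (simp add: borel_prod[symmetric])

lemma borel_measurable_component:
  "i \<in> I \<Longrightarrow> (\<lambda>x. x i) \<in> borel_measurable (unif_Ts I)"
  using measurable_component_singleton[of i I "\<lambda>_. unif_T"]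
  by (subst (asm) measurable_cong_sets[OF refl sets_unif_T])

lemma measurable_first_event [measurable]:
  assumes "finite I" "j \<in> I"
  shows "first_event I j \<in> sets (unif_Ts I)"
proof -
  have "Measurable.pred (unif_Ts I) (\<lambda>x. \<forall>i\<in>I - {j}. x i \<in> T \<and> 0 < snd (cap_map (x j) (x i)))"
  proof (rule pred_intros_finite(3))
    fix i assume i: "i \<in> I - {j}"
    have [measurable]: "(\<lambda>x. x i) \<in> borel_measurable (unif_Ts I)" "(\<lambda>x. x j) \<in> borel_measurable (unif_Ts I)"
      using i assms by (auto intro: borel_measurable_component)
    show "Measurable.pred (unif_Ts I) (\<lambda>x. x i \<in> T \<and> 0 < snd (cap_map (x j) (x i)))"
      by measurable
  qed (use assms in auto)
  then show ?thesis unfolding first_event_def pred_def .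
qed

lemma f0_hull_ge_2:
  assumes "finite S" "S \<subseteq> T"
  shows "2 \<le> f0 (convex hull ({(1,0),(0,1)} \<union> S))"
proof -
  let ?K = "{(1,0),(0,1)} \<union> S"
  have KT: "convex hull ?K \<subseteq> T"
    using assms convex_T by (intro hull_minimal) (auto simp: T_eq)
  have "(1,0) extreme_point_of T"
    by (rule extreme_point_of_Int_supporting_hyperplane_le[of T "(1,0)" 1])
      (auto simp: T_eq inner_prod_def)
  moreover have "(0,1) extreme_point_of T"
    by (rule extreme_point_of_Int_supporting_hyperplane_le[of T "(0,1)" 1])
      (auto simp: T_eq inner_prod_def)
  moreover have "(1,0) \<in> convex hull ?K" "(0,1) \<in> convex hull ?K"
    by (simp_all add: hull_inc)
  ultimately have "{(1,0),(0,1)} \<subseteq> {v. v extreme_point_of (convex hull ?K)}"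
    using KT by (simp add: extreme_point_of_def subset_eq)
  then have "card {(1,0),(0::real,1::real)} \<le> f0 (convex hull ?K)"
    unfolding f0_def using assms by (intro card_mono finite_extreme_points_of_hull) auto
  then show ?thesis by simp
qed

text \<open>
  Fix the neighbour y of (1,0) and sum over the set J of the indices whose points lie in the triangle
  that \<open>cap_map y\<close> takes to T. The images of these points are independent and uniform, and they must
  produce one vertex less. Integrating the weights over y gives, for J of size m, a value depending
  on m only, and the binomial coefficient counting the J of this size cancels its factorials.
\<close>

lemma emeasure_vertex_event_first:
  assumes I: "finite I" "j \<notin> I"
    and IH: "\<And>J k'. k = Suc k' \<Longrightarrow> finite J \<Longrightarrow>
       emeasure (unif_Ts J) (vertex_event J k') = ennreal (chain_prob k' (card J))"
  shows "emeasure (unif_Ts (insert j I)) (vertex_event (insert j I) k \<inter> first_event (insert j I) j)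
     = ennreal (chain_prob k (Suc (card I)) / Suc (card I))"
proof -
  define N where "N = card I"
  let ?E = "vertex_event (insert j I) k \<inter> first_event (insert j I) j"
  \<comment> \<open>The events left for the points in the sub-triangle. There is none for k = 0, since the
    neighbour of (1,0) is itself a vertex.\<close>
  define W where "W = (\<lambda>J. case k of 0 \<Rightarrow> {} | Suc k' \<Rightarrow> vertex_event J k')"
  define p where "p = (\<lambda>m. case k of 0 \<Rightarrow> 0 | Suc k' \<Rightarrow> chain_prob k' m)"
  have p0: "p m \<ge> 0" for m by (simp add: p_def chain_prob_nonneg split: nat.split)
  have W: "W J \<in> sets (unif_Ts J)" "emeasure (unif_Ts J) (W J) = ennreal (p (card J))" if "finite J" for J
    using IH that by (auto simp: W_def p_def split: nat.split)
  have inner: "(\<integral>\<^sup>+x. indicator ?E (x(j := y)) \<partial>unif_Ts I) =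
     (\<Sum>J\<in>Pow I. ennreal (p (card J)) * ennreal (cap_share y ^ card J * rest_share y ^ (N - card J)))"
    if y: "in_open_T y" for y
  proof -
    let ?A = "cap_map y"
    define B C where "B = {x \<in> T. 0 < snd (?A x) \<and> ?A x \<in> T}" and "C = {x \<in> T. 0 < snd (?A x) \<and> ?A x \<notin> T}"
    have [measurable]: "B \<in> sets borel" "C \<in> sets borel" unfolding B_def C_def by measurable
    have yy: "0 < fst y" "0 < snd y" "fst y + snd y < 1" "cap_share y \<ge> 0" "rest_share y \<ge> 0"
      using y by (auto simp: in_open_T_def cap_share_def rest_share_def)
    have pointwise: "indicator ?E (x(j := y)) =
       (\<Sum>J\<in>Pow I. indicator (W J) (\<lambda>i\<in>J. ?A (x i)) * (\<Prod>i\<in>J. indicator B (x i)) * (\<Prod>i\<in>I-J. indicator C (x i)) :: ennreal)"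
      if x: "x \<in> space (unif_Ts I)" for x
    proof -
      define J where "J = {i\<in>I. x i \<in> B}"
      have sp: "x(j := y) \<in> space (unif_Ts (insert j I))" using x by (auto simp: space_PiM PiE_def extensional_def)
      have first: "x(j := y) \<in> first_event (insert j I) j \<longleftrightarrow> (\<forall>i\<in>I. x i \<in> B \<union> C)"
        using sp I by (auto simp: first_event_def B_def C_def)
      have vertex: "x(j := y) \<in> vertex_event (insert j I) k \<longleftrightarrow> (\<lambda>i\<in>J. ?A (x i)) \<in> W J"
        if BC: "\<forall>i\<in>I. x i \<in> B \<union> C"
      proof -
        define Q where "Q = f0 (convex hull ({(1,0),(0,1)} \<union> (\<lambda>i\<in>J. ?A (x i)) ` J))"
        have "(x(j := y)) ` insert j I = insert y (x ` I)" using I by auto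
        moreover have "f0 (convex hull ({(1,0),(0,1)} \<union> insert y (x ` I))) =
           Suc (f0 (convex hull ({(1,0),(0,1)} \<union> (?A ` (x ` I) \<inter> T))))"
          by (rule f0_split_at_first_vertex) (use yy I BC in \<open>auto simp: B_def C_def\<close>)
        moreover have img: "?A ` (x ` I) \<inter> T = (\<lambda>i\<in>J. ?A (x i)) ` J"
          using BC by (auto simp: J_def B_def C_def)
        ultimately have "f0 (convex hull ({(1,0),(0,1)} \<union> (x(j := y)) ` insert j I)) = Suc Q"
          by (simp only: Q_def)
        then have "x(j := y) \<in> vertex_event (insert j I) k \<longleftrightarrow> Suc Q = k + 2"
          using sp unfolding vertex_event_def mem_Collect_eq by (simp only:) blast
        moreover have "(\<lambda>i\<in>J. ?A (x i)) \<in> space (unif_Ts J)" by (auto simp: space_PiM)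
        then have "(\<lambda>i\<in>J. ?A (x i)) \<in> W J \<longleftrightarrow> (\<exists>k'. k = Suc k' \<and> Q = k' + 2)"
          by (auto simp: W_def vertex_event_def Q_def split: nat.split)
        moreover have "2 \<le> Q"
          unfolding Q_def img[symmetric] by (rule f0_hull_ge_2) (use I in auto)
        ultimately show ?thesis by (cases k) auto
      qed
      have "(\<Sum>J\<in>Pow I. indicator (W J) (\<lambda>i\<in>J. ?A (x i)) * (\<Prod>i\<in>J. indicator B (x i)) * (\<Prod>i\<in>I-J. indicator C (x i)) :: ennreal)
         = indicator (W J) (\<lambda>i\<in>J. ?A (x i)) * (\<Prod>i\<in>I. indicator (B \<union> C) (x i))"
        unfolding J_def by (rule sum_Pow_partition_indicator) (use I in \<open>auto simp: B_def C_def\<close>)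
      also have "\<dots> = indicator ?E (x(j := y))"
      proof (cases "\<forall>i\<in>I. x i \<in> B \<union> C")
        case True
        then have "(\<Prod>i\<in>I. indicator (B \<union> C) (x i)) = (1 :: ennreal)" by (intro prod.neutral) auto
        with True first vertex show ?thesis by (simp add: indicator_def)
      next
        case False
        then obtain i where "i \<in> I" "x i \<notin> B \<union> C" by auto
        then have "(\<Prod>i\<in>I. indicator (B \<union> C) (x i)) = (0 :: ennreal)"
          using I by (intro prod_zero bexI[of _ i]) auto
        moreover have "x(j := y) \<notin> ?E" using first False by blast
        ultimately show ?thesis by (simp only: mult_zero_right) simp
      qed
      finally show ?thesis ..
    qed
    have "(\<integral>\<^sup>+x. indicator ?E (x(j := y)) \<partial>unif_Ts I) =
      (\<integral>\<^sup>+x. (\<Sum>J\<in>Pow I. indicator (W J) (\<lambda>i\<in>J. ?A (x i)) * (\<Prod>i\<in>J. indicator B (x i)) * (\<Prod>i\<in>I-J. indicator C (x i))) \<partial>unif_Ts I)"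
      by (rule nn_integral_cong) (rule pointwise)
    also have "\<dots> = (\<Sum>J\<in>Pow I. (\<integral>\<^sup>+x. indicator (W J) (\<lambda>i\<in>J. ?A (x i)) * (\<Prod>i\<in>J. indicator B (x i)) * (\<Prod>i\<in>I-J. indicator C (x i)) \<partial>unif_Ts I))"
    proof (rule nn_integral_sum)
      fix J assume J: "J \<in> Pow I"
      have [measurable]: "W J \<in> sets (unif_Ts J)" using J I by (intro W) (auto intro: finite_subset)
      have [measurable]: "(\<lambda>x. \<lambda>i\<in>J. ?A (x i)) \<in> measurable (unif_Ts I) (unif_Ts J)"
        by (rule measurable_restrict) (use J in auto)
      have [measurable]: "(\<lambda>x. x i) \<in> borel_measurable (unif_Ts I)" if "i \<in> I" for i
        using that by (rule borel_measurable_component)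
      have "(\<lambda>x. \<Prod>i\<in>J. indicator B (x i) :: ennreal) \<in> borel_measurable (unif_Ts I)"
        using J by (intro borel_measurable_prod_ennreal) auto
      moreover have "(\<lambda>x. \<Prod>i\<in>I-J. indicator C (x i) :: ennreal) \<in> borel_measurable (unif_Ts I)"
        using J by (intro borel_measurable_prod_ennreal) auto
      ultimately show "(\<lambda>x. indicator (W J) (\<lambda>i\<in>J. ?A (x i)) * (\<Prod>i\<in>J. indicator B (x i)) * (\<Prod>i\<in>I-J. indicator C (x i)) :: ennreal)
           \<in> borel_measurable (unif_Ts I)"
        by measurable
    qed
    also have "\<dots> = (\<Sum>J\<in>Pow I. ennreal (p (card J)) * ennreal (cap_share y ^ card J * rest_share y ^ (N - card J)))"
    proof (rule sum.cong)
      fix J assume "J \<in> Pow I"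
      then have J: "J \<subseteq> I" "finite J" using I finite_subset by auto
      have "(\<integral>\<^sup>+x. indicator (W J) (\<lambda>i\<in>J. ?A (x i)) * (\<Prod>i\<in>J. indicator B (x i)) * (\<Prod>i\<in>I-J. indicator C (x i)) \<partial>unif_Ts I)
        = ennreal (cap_share y) ^ card J * emeasure unif_T C ^ (card I - card J) * (\<integral>\<^sup>+x. indicator (W J) x \<partial>unif_Ts J)"
        by (rule nn_integral_unif_Ts_push_subset)
          (use nn_integral_cap_map[OF y] I J W in \<open>auto simp: B_def C_def\<close>)
      also have "\<dots> = ennreal (cap_share y) ^ card J * ennreal (rest_share y) ^ (N - card J) * ennreal (p (card J))"
        using W[OF J(2)] emeasure_rest[OF y] by (simp add: C_def N_def)
      finally show "(\<integral>\<^sup>+x. indicator (W J) (\<lambda>i\<in>J. ?A (x i)) * (\<Prod>i\<in>J. indicator B (x i)) * (\<Prod>i\<in>I-J. indicator C (x i)) \<partial>unif_Ts I)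
        = ennreal (p (card J)) * ennreal (cap_share y ^ card J * rest_share y ^ (N - card J))"
        using yy by (simp add: ennreal_mult ennreal_power mult.commute)
    qed simp
    finally show ?thesis .
  qed
  have [measurable]: "?E \<in> sets (unif_Ts (insert j I))"
    using I by (intro sets.Int measurable_vertex_event measurable_first_event) auto
  have "emeasure (unif_Ts (insert j I)) ?E = (\<integral>\<^sup>+x. indicator ?E x \<partial>unif_Ts (insert j I))" by simp
  also have "\<dots> = (\<integral>\<^sup>+y. (\<integral>\<^sup>+x. indicator ?E (x(j := y)) \<partial>unif_Ts I) \<partial>unif_T)"
    by (rule unif_T_prod.product_nn_integral_insert_rev) (use I in auto)
  also have "\<dots> = (\<integral>\<^sup>+y. (\<Sum>J\<in>Pow I. ennreal (p (card J)) * ennreal (cap_share y ^ card J * rest_share y ^ (N - card J))) \<partial>unif_T)"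
    by (rule nn_integral_cong_AE) (use AE_in_open_T in eventually_elim, rule inner)
  also have "\<dots> = (\<Sum>J\<in>Pow I. \<integral>\<^sup>+y. ennreal (p (card J)) * ennreal (cap_share y ^ card J * rest_share y ^ (N - card J)) \<partial>unif_T)"
    by (rule nn_integral_sum) measurable
  also have "\<dots> = (\<Sum>J\<in>Pow I. ennreal (p (card J) * (2 / (N + 1) * (fact (card J) * fact (N + 1 - card J) / fact (N + 2)))))"
  proof (rule sum.cong)
    fix J assume "J \<in> Pow I"
    then have "card J \<le> N" using I by (auto simp: N_def intro: card_mono)
    then have "(\<integral>\<^sup>+y. ennreal (p (card J)) * ennreal (cap_share y ^ card J * rest_share y ^ (N - card J)) \<partial>unif_T)
      = ennreal (p (card J)) * ennreal (2 / (N + 1) * (fact (card J) * fact (N + 1 - card J) / fact (N + 2)))"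
      by (subst nn_integral_cmult) (measurable, simp only: nn_integral_shares of_nat_add of_nat_1)
    also have "\<dots> = ennreal (p (card J) * (2 / (N + 1) * (fact (card J) * fact (N + 1 - card J) / fact (N + 2))))"
      by (rule ennreal_mult[symmetric]) (use p0 in auto)
    finally show "(\<integral>\<^sup>+y. ennreal (p (card J)) * ennreal (cap_share y ^ card J * rest_share y ^ (N - card J)) \<partial>unif_T)
      = ennreal (p (card J) * (2 / (N + 1) * (fact (card J) * fact (N + 1 - card J) / fact (N + 2))))" .
  qed simp
  also have "\<dots> = ennreal (\<Sum>J\<in>Pow I. p (card J) * (2 / (N + 1) * (fact (card J) * fact (N + 1 - card J) / fact (N + 2))))"
    by (rule sum_ennreal) (use p0 in auto)
  also have "(\<Sum>J\<in>Pow I. p (card J) * (2 / (N + 1) * (fact (card J) * fact (N + 1 - card J) / fact (N + 2)))) =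
    (\<Sum>m\<le>N. real (N choose m) * (p m * (2 / (N + 1) * (fact m * fact (N + 1 - m) / fact (N + 2)))))"
    unfolding N_def by (rule sum_Pow_card[OF I(1)])
  also have "\<dots> = (\<Sum>m<Suc N. 2 / (real (Suc N) * (real (Suc N) + 1)) * (real (Suc N - m) * p m) / Suc N)"
  proof (rule sum.cong)
    fix m assume "m \<in> {..<Suc N}"
    then have m: "m \<le> N" by simp
    have c: "real (N choose m) * (fact m * fact (N - m)) = fact N"
      using binomial_fact[OF m, where 'a = real] by simp
    have f1: "fact (N + 1 - m) = real (Suc N - m) * fact (N - m)"
      using m by (simp add: Suc_diff_le)
    have f2: "fact (N + 2) = (real (Suc N) + 1) * (real (Suc N) * fact N)" by (simp add: algebra_simps)
    have "real (N choose m) * (p m * (2 / (N + 1) * (fact m * fact (N + 1 - m) / fact (N + 2)))) =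
      (real (N choose m) * (fact m * fact (N - m))) * (p m * (2 / (N + 1) * real (Suc N - m) / fact (N + 2)))"
      by (simp only: f1) (simp add: ac_simps)
    also have "\<dots> = fact N * (p m * (2 / (N + 1) * real (Suc N - m) / ((real (Suc N) + 1) * (real (Suc N) * fact N))))"
      by (simp only: c f2)
    also have "\<dots> = 2 / (real (Suc N) * (real (Suc N) + 1)) * (real (Suc N - m) * p m) / Suc N"
      by (simp add: divide_simps del: of_nat_Suc of_nat_diff)
    finally show "real (N choose m) * (p m * (2 / (N + 1) * (fact m * fact (N + 1 - m) / fact (N + 2)))) =
       2 / (real (Suc N) * (real (Suc N) + 1)) * (real (Suc N - m) * p m) / Suc N" .
  qed auto
  also have "\<dots> = chain_prob k (Suc N) / Suc N"
    by (cases k) (simp_all add: p_def sum_distrib_left sum_divide_distrib del: of_nat_Suc of_nat_diff sum.lessThan_Suc)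
  finally show ?thesis by (simp add: N_def)
qed

lemma snd_cap_map_eq_0_iff:
  assumes "in_open_T y" "fst x < 1"
  shows "snd (cap_map y x) = 0 \<longleftrightarrow> slope y = slope x"
proof -
  have "snd (cap_map y x) = 0 \<longleftrightarrow> snd y * (1 - fst x) = snd x * (1 - fst y)"
    using assms by (auto simp add: cap_map_def in_open_T_def)
  also have "\<dots> \<longleftrightarrow> slope y = slope x"
    using assms by (simp add: slope_def in_open_T_def frac_eq_eq)
  finally show ?thesis .
qed

lemma disjoint_first_event:
  assumes "i \<in> I" "j \<in> I" "i \<noteq> j"
  shows "first_event I i \<inter> first_event I j = {}"
proof -
  \<comment> \<open>A vanishing denominator would make the coordinate 0, so its positivity also fixes the sign of the
    denominator.\<close>
  have *: "snd x * (1 - fst y) > snd y * (1 - fst x)" if "y \<in> T" "0 < snd (cap_map y x)" for x y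
  proof -
    have "1 - fst y - snd y \<ge> 0" "1 - fst y - snd y \<noteq> 0" using that by (auto simp: T_eq cap_map_def)
    then show ?thesis using that(2) by (simp add: cap_map_def zero_less_divide_iff)
  qed
  show ?thesis
  proof (rule ccontr)
    assume "first_event I i \<inter> first_event I j \<noteq> {}"
    then obtain x where "x i \<in> T" "x j \<in> T" "0 < snd (cap_map (x i) (x j))" "0 < snd (cap_map (x j) (x i))"
      using assms by (auto simp: first_event_def)
    with *[of "x i" "x j"] *[of "x j" "x i"] show False by simp
  qed
qed

text \<open>
  For a fixed j-th point, being on the line through (1,0) and this point is a null event for the i-th
  one.
\<close>

lemma AE_unif_Ts_distinct_slopes:
  assumes "finite I" "i \<in> I" "j \<in> I" "i \<noteq> j"
  shows "AE x in unif_Ts I. snd (cap_map (x j) (x i)) \<noteq> 0"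
proof -
  define I' where "I' = I - {j}"
  have I: "I = insert j I'" "finite I'" "j \<notin> I'" "i \<in> I'" using assms by (auto simp: I'_def)
  have comp[measurable]: "(\<lambda>x. x k) \<in> borel_measurable (unif_Ts I)" if "k \<in> I" for k
    using that by (rule borel_measurable_component)
  have meas: "Measurable.pred (unif_Ts I) (\<lambda>x. snd (cap_map (x j) (x i)) \<noteq> 0)"
    using assms by measurable
  have "(\<integral>\<^sup>+x. indicator {x. \<not> snd (cap_map (x j) (x i)) \<noteq> 0} x \<partial>unif_Ts I) =
    (\<integral>\<^sup>+y. (\<integral>\<^sup>+x. indicator {x. \<not> snd (cap_map (x j) (x i)) \<noteq> 0} (x(j := y)) \<partial>unif_Ts I') \<partial>unif_T)"
  proof (unfold I(1), rule unif_T_prod.product_nn_integral_insert_rev[OF I(2,3)])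
    have "Measurable.pred (unif_Ts (insert j I')) (\<lambda>x. \<not> snd (cap_map (x j) (x i)) \<noteq> 0)"
      using meas unfolding I(1) by (rule pred_intros_logic(2))
    then show "indicator {x. \<not> snd (cap_map (x j) (x i)) \<noteq> 0} \<in> borel_measurable (unif_Ts (insert j I'))"
      by (intro borel_measurable_indicator'[where f = "\<lambda>x. x" and A = "\<lambda>_. {x. \<not> snd (cap_map (x j) (x i)) \<noteq> 0}"])
        (simp add: pred_def)
  qed
  also have "\<dots> = (\<integral>\<^sup>+y. 0 \<partial>unif_T)"
  proof (rule nn_integral_cong_AE)
    show "AE y in unif_T. (\<integral>\<^sup>+x. indicator {x. \<not> snd (cap_map (x j) (x i)) \<noteq> 0} (x(j := y)) \<partial>unif_Ts I') = 0"
      using AE_in_open_T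
    proof eventually_elim
      case (elim y)
      have "AE x in unif_Ts I'. snd (cap_map y (x i)) \<noteq> 0"
        by (rule AE_PiM_component) (use AE_snd_cap_map_nonzero[OF elim] I prob_space_unif_T in auto)
      then have "AE x in unif_Ts I'. indicator {x. \<not> snd (cap_map (x j) (x i)) \<noteq> 0} (x(j := y)) = (0::ennreal)"
        by eventually_elim (use assms in \<open>auto simp: indicator_def\<close>)
      then show ?case by (subst nn_integral_cong_AE[where v = "\<lambda>_. 0"]) auto
    qed
  qed
  finally show ?thesis
    using meas by (subst AE_iff_nn_integral) (auto simp: pred_def)
qed

text \<open>
  Almost surely exactly one point has the smallest slope, and each of them is equally likely to be it.
\<close>

theorem emeasure_vertex_event:
  assumes "finite I"
  shows "emeasure (unif_Ts I) (vertex_event I k) = ennreal (chain_prob k (card I))"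
  using assms
proof (induction k arbitrary: I rule: less_induct)
  case (less k)
  show ?case
  proof (cases "I = {}")
    case True
    interpret prob_space "unif_Ts {}" by (rule prob_space_PiM) (rule prob_space_unif_T)
    have "vertex_event {} k = (if k = 0 then space (unif_Ts {}) else {})"
      using f0_segment by (auto simp: vertex_event_def)
    then show ?thesis using True emeasure_space_1 by (cases k) simp_all
  next
    case False
    have AE1: "AE x in unif_Ts I. \<forall>i\<in>I. in_open_T (x i)"
      using less.prems AE_in_open_T prob_space_unif_T
      by (intro AE_finite_allI AE_PiM_component) auto
    have AE2: "AE x in unif_Ts I. \<forall>i\<in>I. \<forall>j\<in>I. i \<noteq> j \<longrightarrow> snd (cap_map (x j) (x i)) \<noteq> 0"
      using less.prems AE_unif_Ts_distinct_slopes[OF less.prems]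
      by (intro AE_finite_allI) auto
    have "emeasure (unif_Ts I) (vertex_event I k) =
       emeasure (unif_Ts I) (\<Union>j\<in>I. vertex_event I k \<inter> first_event I j)"
    proof (rule emeasure_eq_AE)
      show "AE x in unif_Ts I. x \<in> vertex_event I k \<longleftrightarrow> x \<in> (\<Union>j\<in>I. vertex_event I k \<inter> first_event I j)"
        using AE1 AE2 AE_space
      proof eventually_elim
        case (elim x)
        obtain j where j: "j \<in> I" "\<And>i. i \<in> I \<Longrightarrow> slope (x j) \<le> slope (x i)"
          using ex_min_if_finite[of "(\<lambda>i. slope (x i)) ` I"] less.prems False
          by (auto simp: not_less)
        have "x i \<in> T \<and> 0 < snd (cap_map (x j) (x i))" if i: "i \<in> I - {j}" for i
        proof -
          have g: "in_open_T (x i)" "in_open_T (x j)" using elim i j by auto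
          then have "fst (x i) < 1" by (simp add: in_open_T_def)
          then have "slope (x j) < slope (x i)"
            using snd_cap_map_eq_0_iff[OF g(2), of "x i"] elim i j by force
          then show ?thesis using snd_cap_map_pos_iff[OF g(2) \<open>fst (x i) < 1\<close>] g by (simp add: in_open_T_def)
        qed
        then have "x \<in> first_event I j" using elim by (simp add: first_event_def)
        with j show ?case by auto
      qed
    qed (use less.prems in auto)
    also have "\<dots> = (\<Sum>j\<in>I. emeasure (unif_Ts I) (vertex_event I k \<inter> first_event I j))"
    proof (rule sum_emeasure[symmetric])
      show "disjoint_family_on (\<lambda>j. vertex_event I k \<inter> first_event I j) I"
        using disjoint_first_event by (fastforce simp: disjoint_family_on_def)
    qed (use less.prems in auto)
    also have "\<dots> = (\<Sum>j\<in>I. ennreal (chain_prob k (card I) / card I))"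
    proof (rule sum.cong)
      fix j assume j: "j \<in> I"
      have "card I = Suc (card (I - {j}))"
        using card_Suc_Diff1[OF less.prems j] by (rule sym)
      moreover have "insert j (I - {j}) = I" using j by auto
      ultimately show "emeasure (unif_Ts I) (vertex_event I k \<inter> first_event I j) = ennreal (chain_prob k (card I) / card I)"
        using emeasure_vertex_event_first[of "I - {j}" j k] less by simp
    qed simp
    also have "\<dots> = ennreal (\<Sum>j\<in>I. chain_prob k (card I) / card I)"
      by (rule sum_ennreal) (simp add: chain_prob_nonneg)
    also have "(\<Sum>j\<in>I. chain_prob k (card I) / card I) = chain_prob k (card I)"
      using False less.prems by simp
    finally show ?thesis .
  qed
qed

theorem vertex_prob_eq_chain_prob:
  fixes M :: "'a measure"
  assumes "prob_space M" "prob_space.indep_vars M (\<lambda>_. borel) X {1..n}"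
    and "\<And>i. i \<in> {1..n} \<Longrightarrow> distr M borel (X i) = unif_T" and "n > 0"
  shows "vertex_prob M X n k = chain_prob k n"
proof -
  interpret prob_space M by fact
  have rv: "X i \<in> borel_measurable M" if "i \<in> {1..n}" for i
    using assms(2) that by (auto simp: indep_vars_def)
  define Y where "Y = (\<lambda>\<omega>. \<lambda>i\<in>{1..n}. X i \<omega>)"
  have Y[measurable]: "Y \<in> measurable M (Pi\<^sub>M {1..n} (\<lambda>_. borel))"
    unfolding Y_def by (rule measurable_restrict) (rule rv)
  have "distr M (Pi\<^sub>M {1..n} (\<lambda>_. borel)) Y = (\<Pi>\<^sub>M i\<in>{1..n}. distr M borel (X i))"
    unfolding Y_def using assms(2,4) rv by (subst indep_vars_iff_distr_eq_PiM'[symmetric]) auto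
  also have "\<dots> = unif_Ts {1..n}" by (rule PiM_cong) (use assms(3) in auto)
  finally have distr: "distr M (Pi\<^sub>M {1..n} (\<lambda>_. borel)) Y = unif_Ts {1..n}" .
  have ev: "vertex_event {1..n} k \<in> sets (Pi\<^sub>M {1..n} (\<lambda>_. borel))"
    using measurable_vertex_event[of "{1..n}" k] by (simp only: sets_unif_Ts finite_atLeastAtMost)
  have "emeasure (unif_Ts {1..n}) (vertex_event {1..n} k) = emeasure M (Y -` vertex_event {1..n} k \<inter> space M)"
    unfolding distr[symmetric] by (rule emeasure_distr[OF Y ev])
  also have "Y -` vertex_event {1..n} k \<inter> space M = {\<omega> \<in> space M. f0 (random_polygon n X \<omega>) = k + 2}"
    by (auto simp: vertex_event_def random_polygon_def Y_def space_PiM)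
  finally have "emeasure M {\<omega> \<in> space M. f0 (random_polygon n X \<omega>) = k + 2} = ennreal (chain_prob k n)"
    using emeasure_vertex_event[of "{1..n}" k] by simp
  then show ?thesis unfolding vertex_prob_def measure_def by (simp add: chain_prob_nonneg)
qed

section \<open>Log-concavity of the law\<close>

lemma chain_prob_eq_0: "n < k \<Longrightarrow> chain_prob k n = 0"
proof (induction k arbitrary: n)
  case (Suc k)
  then have "chain_prob k m = 0" if "m < n" for m using that by auto
  then show ?case by simp
qed simp

lemma chain_prob_pos: "0 < k \<Longrightarrow> k \<le> n \<Longrightarrow> 0 < chain_prob k n"
proof (induction k arbitrary: n)
  case (Suc k)
  have "\<exists>m<n. 0 < chain_prob k m"
  proof (cases "k = 0")
    case True
    then show ?thesis using Suc.prems by (intro exI[of _ 0]) auto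
  next
    case False
    then show ?thesis using Suc by (intro exI[of _ "n - 1"]) auto
  qed
  then obtain m where m: "m < n" "0 < chain_prob k m" by auto
  have "0 < (\<Sum>m<n. real (n - m) * chain_prob k m)"
    by (rule sum_pos2[of _ m]) (use m chain_prob_nonneg in auto)
  then show ?case using Suc.prems by simp
qed simp

text \<open>
  The kernel \<open>(n - m)\<^sup>+\<close> is totally positive of order two. Truncated subtraction is the positive part
  here.
\<close>

lemma linear_kernel_minors_nonneg:
  fixes n n' m m' :: nat
  assumes "n \<le> n'" "m \<le> m'"
  shows "real (n - m') * real (n' - m) \<le> real (n - m) * real (n' - m')"
proof (cases "m' \<le> n")
  case True
  then have "real (n - m) * real (n' - m') - real (n - m') * real (n' - m) = (real n' - real n) * (real m' - real m)"
    using assms by (simp add: of_nat_diff algebra_simps)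
  moreover have "\<dots> \<ge> 0" using assms by simp
  ultimately show ?thesis by linarith
qed simp

text \<open>
  The Cauchy-Binet formula for two rows and columns. Summing over all pairs instead of the ordered
  ones counts each minor twice.
\<close>

lemma cauchy_binet_2:
  fixes f g u v :: "nat \<Rightarrow> real"
  shows "2 * ((\<Sum>m<N. u m * f m) * (\<Sum>m<N. v m * g m) - (\<Sum>m<N. v m * f m) * (\<Sum>m<N. u m * g m)) =
    (\<Sum>m<N. \<Sum>m'<N. (f m * g m' - f m' * g m) * (u m * v m' - u m' * v m))"
proof -
  have "(\<Sum>m<N. \<Sum>m'<N. (f m * g m' - f m' * g m) * (u m * v m' - u m' * v m)) =
     (\<Sum>m<N. \<Sum>m'<N. (u m * f m) * (v m' * g m')) - (\<Sum>m<N. \<Sum>m'<N. (v m * f m) * (u m' * g m'))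
     - (\<Sum>m<N. \<Sum>m'<N. (u m * g m) * (v m' * f m')) + (\<Sum>m<N. \<Sum>m'<N. (v m * g m) * (u m' * f m'))"
    by (simp only: sum.distrib[symmetric] sum_subtractf[symmetric])
      (intro sum.cong refl, simp add: algebra_simps)
  then show ?thesis by (simp only: sum_product[symmetric]) (simp add: algebra_simps)
qed

text \<open>
  The ratio of consecutive \<open>chain_prob\<close> grows with the number of points. By Cauchy-Binet the minors
  for k + 1 are sums of products of minors for k with minors of the kernel.
\<close>

lemma chain_prob_minors_nonneg:
  assumes "n \<le> n'"
  shows "chain_prob k n' * chain_prob (Suc k) n \<le> chain_prob k n * chain_prob (Suc k) n'"
  using assms
proof (induction k arbitrary: n n')
  case 0
  then show ?case
    using chain_prob_nonneg[of 1 n'] by (cases "n = 0"; cases "n' = 0") (auto simp del: chain_prob.simps(2))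
next
  case (Suc k)
  define c c' where "c = 2 / (real n * (real n + 1))" and "c' = 2 / (real n' * (real n' + 1))"
  let ?u = "\<lambda>m. real (n - m)" and ?v = "\<lambda>m. real (n' - m)"
  let ?f = "chain_prob k" and ?g = "chain_prob (Suc k)"
  have ext: "(\<Sum>m<n. ?u m * h m) = (\<Sum>m<n'. ?u m * h m)" for h :: "nat \<Rightarrow> real"
    by (rule sum.mono_neutral_left) (use Suc.prems in auto)
  have eq: "chain_prob (Suc k) n = c * (\<Sum>m<n'. ?u m * ?f m)" "chain_prob (Suc (Suc k)) n = c * (\<Sum>m<n'. ?u m * ?g m)"
    "chain_prob (Suc k) n' = c' * (\<Sum>m<n'. ?v m * ?f m)" "chain_prob (Suc (Suc k)) n' = c' * (\<Sum>m<n'. ?v m * ?g m)"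
    unfolding chain_prob.simps(2)[of _ n] chain_prob.simps(2)[of _ n'] c_def c'_def ext by (rule refl)+
  have "0 \<le> (\<Sum>m<n'. \<Sum>m'<n'. (?f m * ?g m' - ?f m' * ?g m) * (?u m * ?v m' - ?u m' * ?v m))"
  proof (intro sum_nonneg)
    fix m m'
    show "0 \<le> (?f m * ?g m' - ?f m' * ?g m) * (?u m * ?v m' - ?u m' * ?v m)"
    proof (cases "m \<le> m'")
      case True
      then show ?thesis
        using Suc.IH[OF True] linear_kernel_minors_nonneg[OF Suc.prems True] by (intro mult_nonneg_nonneg) auto
    next
      case False
      then have "m' \<le> m" by simp
      then show ?thesis
        using Suc.IH[OF \<open>m' \<le> m\<close>] linear_kernel_minors_nonneg[OF Suc.prems \<open>m' \<le> m\<close>]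
        by (intro mult_nonpos_nonpos) auto
    qed
  qed
  also have "\<dots> = 2 * ((\<Sum>m<n'. ?u m * ?f m) * (\<Sum>m<n'. ?v m * ?g m) - (\<Sum>m<n'. ?v m * ?f m) * (\<Sum>m<n'. ?u m * ?g m))"
    by (rule cauchy_binet_2[symmetric])
  finally have "(\<Sum>m<n'. ?v m * ?f m) * (\<Sum>m<n'. ?u m * ?g m) \<le> (\<Sum>m<n'. ?u m * ?f m) * (\<Sum>m<n'. ?v m * ?g m)"
    by simp
  then have "(c * c') * ((\<Sum>m<n'. ?v m * ?f m) * (\<Sum>m<n'. ?u m * ?g m)) \<le> (c * c') * ((\<Sum>m<n'. ?u m * ?f m) * (\<Sum>m<n'. ?v m * ?g m))"
    by (rule mult_left_mono) (simp add: c_def c'_def)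
  then show ?case unfolding eq by (simp only: ac_simps)
qed

text \<open>
  Both sides expand by the recursion into averages over m < n with the same weights, and termwise
  the comparison is the previous lemma for m and n.
\<close>

lemma chain_prob_log_concave:
  "chain_prob k n * chain_prob (Suc (Suc k)) n \<le> (chain_prob (Suc k) n)\<^sup>2"
proof -
  define c where "c = 2 / (real n * (real n + 1))"
  have "(\<Sum>m<n. real (n - m) * chain_prob (Suc k) m) * chain_prob k n =
      (\<Sum>m<n. real (n - m) * (chain_prob k n * chain_prob (Suc k) m))"
    by (simp add: sum_distrib_right sum_distrib_left ac_simps del: chain_prob.simps)
  also have "\<dots> \<le> (\<Sum>m<n. real (n - m) * (chain_prob k m * chain_prob (Suc k) n))"
    by (intro sum_mono mult_left_mono chain_prob_minors_nonneg) auto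
  also have "\<dots> = (\<Sum>m<n. real (n - m) * chain_prob k m) * chain_prob (Suc k) n"
    by (simp add: sum_distrib_right sum_distrib_left ac_simps del: chain_prob.simps)
  finally have "c * ((\<Sum>m<n. real (n - m) * chain_prob (Suc k) m) * chain_prob k n) \<le>
     c * ((\<Sum>m<n. real (n - m) * chain_prob k m) * chain_prob (Suc k) n)"
    by (rule mult_left_mono) (simp add: c_def)
  then show ?thesis
    unfolding power2_eq_square
    by (subst chain_prob.simps(2)[of "Suc k"], subst (1) chain_prob.simps(2)[of k])
       (simp add: c_def ac_simps del: chain_prob.simps)
qed

text \<open>
  Log-concavity with positive terms forbids a descent followed by an ascent. Positivity between l
  and r is essential, since 1, 0, 0, 1 satisfies the inequalities.
\<close>

lemma log_concave_imp_min_le: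
  fixes a :: "nat \<Rightarrow> real"
  assumes lc: "\<And>k. a k * a (Suc (Suc k)) \<le> (a (Suc k))\<^sup>2"
    and pos: "\<And>k. l \<le> k \<Longrightarrow> k \<le> r \<Longrightarrow> 0 < a k"
    and k: "l \<le> k" "k \<le> r"
  shows "min (a l) (a r) \<le> a k"
proof (rule ccontr)
  assume "\<not> ?thesis"
  then have less: "a k < a l" "a k < a r" by auto
  have "k \<noteq> l" using less by auto
  have "\<exists>j. l \<le> j \<and> j < k \<and> a (Suc j) < a j"
  proof (rule ccontr)
    assume "\<not> ?thesis"
    then have up: "a j \<le> a (Suc j)" if "l \<le> j" "j < k" for j using that by (auto simp: not_less)
    have "a l \<le> a i" if "l \<le> i" "i \<le> k" for i
      using that
    proof (induction i rule: dec_induct)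
      case (step i)
      then show ?case using up[of i] by auto
    qed simp
    with less k show False by force
  qed
  then obtain j where j: "l \<le> j" "j < k" "a (Suc j) < a j" by auto
  have desc: "a (Suc i) < a i" if "j \<le> i" "i < r" for i
    using that
  proof (induction i rule: dec_induct)
    case (step i)
    then have "a (Suc i) < a i" by simp
    have p: "0 < a i" "0 < a (Suc i)" using pos[of i] pos[of "Suc i"] step j by auto
    have "a i * a (Suc (Suc i)) \<le> a (Suc i) * a (Suc i)" using lc[of i] by (simp add: power2_eq_square)
    also have "\<dots> < a i * a (Suc i)" using p \<open>a (Suc i) < a i\<close> by simp
    finally show ?case using p by simp
  qed (use j in simp)
  have "a i \<le> a k" if "k \<le> i" "i \<le> r" for i
    using that
  proof (induction i rule: dec_induct)
    case (step i)
    then show ?case using desc[of i] j by auto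
  qed simp
  with less k show False by force
qed

section \<open>Growth of the generating function\<close>

definition chain_gf :: "real \<Rightarrow> nat \<Rightarrow> real" where
  "chain_gf z n = (\<Sum>k\<le>n. chain_prob k n * z ^ k)"

lemma chain_gf_0: "chain_gf z 0 = 1"
  by (simp add: chain_gf_def)

lemma chain_gf_rec:
  assumes "n > 0"
  shows "real n * (real n + 1) * chain_gf z n = 2 * z * (\<Sum>m<n. real (n - m) * chain_gf z m)"
proof -
  obtain N where N: "n = Suc N" using assms by (cases n) auto
  have ext: "chain_gf z m = (\<Sum>k\<le>N. chain_prob k m * z ^ k)" if "m < n" for m
    unfolding chain_gf_def
    by (rule sum.mono_neutral_left) (use that N in \<open>auto simp: chain_prob_eq_0\<close>)
  have "chain_gf z n = (\<Sum>k\<le>N. chain_prob (Suc k) n * z ^ Suc k)"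
    unfolding chain_gf_def N by (subst sum.atMost_Suc_shift) simp
  also have "\<dots> = (\<Sum>k\<le>N. 2 * z / (real n * (real n + 1)) * (\<Sum>m<n. real (n - m) * (chain_prob k m * z ^ k)))"
    by (intro sum.cong refl) (simp add: sum_distrib_left sum_distrib_right ac_simps del: of_nat_diff)
  also have "\<dots> = 2 * z / (real n * (real n + 1)) * (\<Sum>k\<le>N. \<Sum>m<n. real (n - m) * (chain_prob k m * z ^ k))"
    by (simp only: sum_distrib_left)
  also have "(\<Sum>k\<le>N. \<Sum>m<n. real (n - m) * (chain_prob k m * z ^ k)) = (\<Sum>m<n. \<Sum>k\<le>N. real (n - m) * (chain_prob k m * z ^ k))"
    by (rule sum.swap)
  also have "\<dots> = (\<Sum>m<n. real (n - m) * chain_gf z m)"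
    by (intro sum.cong refl) (simp add: ext sum_distrib_left)
  finally show ?thesis using assms by simp
qed

lemma chain_gf_pos:
  assumes "z > 0"
  shows "chain_gf z n > 0"
proof (cases "n = 0")
  case False
  show ?thesis unfolding chain_gf_def
    by (rule sum_pos2[of _ n]) (use False assms chain_prob_pos[of n n] chain_prob_nonneg in auto)
qed (simp add: chain_gf_0)

text \<open>
  The generalised binomial coefficient (n + a choose n), the n-th coefficient of \<open>(1 - x)^(-a-1)\<close>.
\<close>

definition shifted_binomial :: "real \<Rightarrow> nat \<Rightarrow> real" where
  "shifted_binomial a n = pochhammer (a + 1) n / fact n"

lemma shifted_binomial_Suc: "(real n + 1) * shifted_binomial a (Suc n) = (real n + 1 + a) * shifted_binomial a n"
  by (simp add: shifted_binomial_def pochhammer_Suc divide_simps) (simp add: algebra_simps)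

lemma shifted_binomial_pos: "a > -1 \<Longrightarrow> shifted_binomial a n > 0"
  by (simp add: shifted_binomial_def pochhammer_pos)

lemma shifted_binomial_sum:
  assumes "a > -1"
  shows "(\<Sum>m<n. shifted_binomial a m) = real n * shifted_binomial a n / (a + 1)"
proof (induction n)
  case (Suc n)
  have "real (Suc n) * shifted_binomial a (Suc n) = (real n + 1 + a) * shifted_binomial a n"
    using shifted_binomial_Suc[of n a] by (simp add: add.commute)
  then show ?case using Suc assms by (simp add: field_simps)
qed simp

text \<open>
  Convolution with n multiplies the generating function \<open>(1 - x)^(-a-1)\<close> by \<open>x / (1 - x)^2\<close>, which
  shifts a by 2 and the index by 1.
\<close>

lemma shifted_binomial_convolution:
  assumes "a > -1"
  shows "(\<Sum>m<n. real (n - m) * shifted_binomial a m) = real n * (real n + 1 + a) / ((a + 1) * (a + 2)) * shifted_binomial a n"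
proof (induction n)
  case (Suc n)
  have a: "a + 1 \<noteq> 0" "a + 2 \<noteq> 0" using assms by auto
  have "(\<Sum>m<Suc n. real (Suc n - m) * shifted_binomial a m) = (\<Sum>m<Suc n. (real (n - m) * shifted_binomial a m + shifted_binomial a m))"
    by (intro sum.cong refl) (auto simp: Suc_diff_le algebra_simps)
  also have "\<dots> = (\<Sum>m<n. real (n - m) * shifted_binomial a m) + (\<Sum>m<Suc n. shifted_binomial a m)"
    by (simp add: sum.distrib)
  also have "\<dots> = real n * (real n + 1 + a) / ((a + 1) * (a + 2)) * shifted_binomial a n + real (Suc n) * shifted_binomial a (Suc n) / (a + 1)"
    by (simp only: Suc shifted_binomial_sum[OF assms])
  also have "real n * (real n + 1 + a) / ((a + 1) * (a + 2)) * shifted_binomial a n =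
     real n / ((a + 1) * (a + 2)) * ((real n + 1) * shifted_binomial a (Suc n))"
    by (simp add: shifted_binomial_Suc)
  also have "\<dots> + real (Suc n) * shifted_binomial a (Suc n) / (a + 1) =
     real (Suc n) * (real (Suc n) + 1 + a) / ((a + 1) * (a + 2)) * shifted_binomial a (Suc n)"
    using a by (simp add: divide_simps) (simp add: algebra_simps)
  finally show ?case .
qed simp

text \<open>
  This is Gauss' product for the Gamma function, and the limit is \<open>1 / \<Gamma>(a + 1)\<close>.
\<close>

lemma shifted_binomial_asymp:
  assumes "a > -1"
  shows "\<exists>L>0. (\<lambda>n. shifted_binomial a n / real n powr a) \<longlonglongrightarrow> L"
proof (intro exI conjI)
  show "0 < rGamma (a + 1)"
    using Gamma_real_pos[of "a + 1"] assms by (simp add: rGamma_inverse_Gamma)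
  have "(\<lambda>n. rGamma_series (a + 1) n * (real n / (a + 1 + real n))) \<longlonglongrightarrow> rGamma (a + 1) * 1"
    by (intro tendsto_mult rGamma_series_LIMSEQ) real_asymp
  moreover have "\<forall>\<^sub>F n in sequentially. rGamma_series (a + 1) n * (real n / (a + 1 + real n)) = shifted_binomial a n / real n powr a"
    using eventually_gt_at_top[of 0]
  proof eventually_elim
    case (elim n)
    have "exp ((a + 1) * ln (real n)) = real n powr a * real n"
      using elim by (simp add: powr_def distrib_right exp_add)
    moreover have "a + 1 + real n > 0" using assms elim by simp
    ultimately show ?case using elim
      by (simp add: rGamma_series_def shifted_binomial_def pochhammer_Suc)
  qed
  ultimately show "(\<lambda>n. shifted_binomial a n / real n powr a) \<longlonglongrightarrow> rGamma (a + 1)"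
    by (simp add: Lim_transform_eventually)
qed

text \<open>
  The larger root a of \<open>(a + 1) (a + 2) = 2 z\<close>.
\<close>

definition growth :: "real \<Rightarrow> real" where
  "growth z = (sqrt (1 + 8 * z) - 3) / 2"

lemma growth_gt: "z > 0 \<Longrightarrow> growth z > -1"
  by (simp add: growth_def real_less_rsqrt)

lemma growth_root: "z > 0 \<Longrightarrow> (growth z + 1) * (growth z + 2) = 2 * z"
proof -
  assume "z > 0"
  then have "(sqrt (1 + 8 * z))\<^sup>2 = 1 + 8 * z" by simp
  then show ?thesis by (simp add: growth_def field_simps power2_eq_square)
qed

text \<open>
  A discrete comparison principle: the kernel is nonnegative, so an inequality up to N propagates to
  all n, and the constant only has to take care of the first values.
\<close>

lemma linear_convolution_comparison:
  fixes F K :: "nat \<Rightarrow> real"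
  assumes z: "z > 0" and F: "\<And>n. F n > 0" and K: "\<And>n. K n > 0"
    and sub: "\<And>n. n > N \<Longrightarrow> real n * (real n + 1) * F n \<le> 2 * z * (\<Sum>m<n. real (n - m) * F m)"
    and super: "\<And>n. n > N \<Longrightarrow> 2 * z * (\<Sum>m<n. real (n - m) * K m) \<le> real n * (real n + 1) * K n"
  shows "\<exists>C>0. \<forall>n. F n \<le> C * K n"
proof (intro exI conjI allI)
  define C where "C = (\<Sum>m\<le>N. F m / K m)"
  show C: "C > 0" unfolding C_def by (rule sum_pos) (use F K in auto)
  fix n show "F n \<le> C * K n"
  proof (induction n rule: less_induct)
    case (less n)
    show ?case
    proof (cases "n \<le> N")
      case True
      have "F n / K n \<le> C" unfolding C_def
        by (rule member_le_sum) (use True F K in \<open>auto intro: less_imp_le\<close>)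
      then show ?thesis using K[of n] by (simp add: divide_le_eq)
    next
      case False
      then have n: "n > N" by simp
      have "real n * (real n + 1) * F n \<le> 2 * z * (\<Sum>m<n. real (n - m) * F m)" by (rule sub[OF n])
      also have "\<dots> \<le> 2 * z * (\<Sum>m<n. real (n - m) * (C * K m))"
        using z less.IH by (intro mult_left_mono sum_mono) auto
      also have "\<dots> = C * (2 * z * (\<Sum>m<n. real (n - m) * K m))"
        by (simp add: sum_distrib_left ac_simps)
      also have "\<dots> \<le> C * (real n * (real n + 1) * K n)" using C super[OF n] by simp
      also have "\<dots> = real n * (real n + 1) * (C * K n)" by (simp add: ac_simps)
      finally show ?thesis using n by simp
    qed
  qed
qed

text \<open>
  By the convolution identity the claim is \<open>2 z (n + 1 + a) \<le> (a + 1) (a + 2) (n + 1)\<close>, which the strict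
  gap between the leading coefficients makes true for large n.
\<close>

lemma shifted_binomial_super:
  assumes "a > -1" "2 * z < (a + 1) * (a + 2)"
  shows "\<exists>N. \<forall>n>N. 2 * z * (\<Sum>m<n. real (n - m) * shifted_binomial a m) \<le> real n * (real n + 1) * shifted_binomial a n"
proof -
  define P where "P = (a + 1) * (a + 2)"
  have P: "P > 0" "2 * z < P" using assms by (auto simp: P_def)
  have "\<forall>\<^sub>F n in sequentially. 2 * z * (real n + 1 + a) \<le> P * (real n + 1)"
    using P by real_asymp
  then obtain N where N: "\<And>n. n \<ge> N \<Longrightarrow> 2 * z * (real n + 1 + a) \<le> P * (real n + 1)"
    by (auto simp: eventually_sequentially)
  have "2 * z * (\<Sum>m<n. real (n - m) * shifted_binomial a m) \<le> real n * (real n + 1) * shifted_binomial a n" if "n > N" for n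
  proof -
    have "2 * z * (\<Sum>m<n. real (n - m) * shifted_binomial a m) = (2 * z * (real n + 1 + a)) * (real n / P * shifted_binomial a n)"
      unfolding shifted_binomial_convolution[OF assms(1)] P_def by simp
    also have "\<dots> \<le> (P * (real n + 1)) * (real n / P * shifted_binomial a n)"
      using N[of n] that P shifted_binomial_pos[OF assms(1), of n] by (intro mult_right_mono) auto
    also have "\<dots> = real n * (real n + 1) * shifted_binomial a n" using P by simp
    finally show ?thesis .
  qed
  then show ?thesis by blast
qed

lemma shifted_binomial_sub:
  assumes "a > -1" "(a + 1) * (a + 2) < 2 * z"
  shows "\<exists>N. \<forall>n>N. real n * (real n + 1) * shifted_binomial a n \<le> 2 * z * (\<Sum>m<n. real (n - m) * shifted_binomial a m)"
proof -
  define P where "P = (a + 1) * (a + 2)"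
  have P: "P > 0" "P < 2 * z" using assms by (auto simp: P_def)
  have "\<forall>\<^sub>F n in sequentially. P * (real n + 1) \<le> 2 * z * (real n + 1 + a)"
    using P by real_asymp
  then obtain N where N: "\<And>n. n \<ge> N \<Longrightarrow> P * (real n + 1) \<le> 2 * z * (real n + 1 + a)"
    by (auto simp: eventually_sequentially)
  have "real n * (real n + 1) * shifted_binomial a n \<le> 2 * z * (\<Sum>m<n. real (n - m) * shifted_binomial a m)" if "n > N" for n
  proof -
    have "real n * (real n + 1) * shifted_binomial a n = (P * (real n + 1)) * (real n / P * shifted_binomial a n)" using P by simp
    also have "\<dots> \<le> (2 * z * (real n + 1 + a)) * (real n / P * shifted_binomial a n)"
      using N[of n] that P shifted_binomial_pos[OF assms(1), of n] by (intro mult_right_mono) auto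
    also have "\<dots> = 2 * z * (\<Sum>m<n. real (n - m) * shifted_binomial a m)"
      unfolding shifted_binomial_convolution[OF assms(1)] P_def by simp
    finally show ?thesis .
  qed
  then show ?thesis by blast
qed

lemma chain_gf_upper:
  assumes z: "z > 0" and "\<delta> > 0"
  shows "\<forall>\<^sub>F n in sequentially. chain_gf z n \<le> real n powr (growth z + \<delta>)"
proof -
  define a where "a = growth z + \<delta> / 2"
  have a: "a > -1" "a > growth z" using growth_gt[OF z] \<open>\<delta> > 0\<close> by (auto simp: a_def)
  have "2 * z < (a + 1) * (a + 2)"
    unfolding growth_root[OF z, symmetric] using a growth_gt[OF z] by (intro mult_strict_mono) auto
  then obtain N where N: "\<And>n. n > N \<Longrightarrow> 2 * z * (\<Sum>m<n. real (n - m) * shifted_binomial a m) \<le> real n * (real n + 1) * shifted_binomial a n"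
    using shifted_binomial_super[OF a(1)] by blast
  obtain C where C: "C > 0" "\<And>n. chain_gf z n \<le> C * shifted_binomial a n"
    using linear_convolution_comparison[of z "chain_gf z" "shifted_binomial a" N]
      z chain_gf_pos[OF z] shifted_binomial_pos[OF a(1)] N chain_gf_rec[of _ z] by fastforce
  obtain L where L: "L > 0" "(\<lambda>n. shifted_binomial a n / real n powr a) \<longlonglongrightarrow> L"
    using shifted_binomial_asymp[OF a(1)] by blast
  have 1: "\<forall>\<^sub>F n in sequentially. shifted_binomial a n / real n powr a < L + 1"
    using order_tendstoD(2)[OF L(2), of "L + 1"] by simp
  have 2: "\<forall>\<^sub>F n::nat in sequentially. C * (L + 1) \<le> real n powr (\<delta> / 2)"
    using \<open>\<delta> > 0\<close> by real_asymp
  show ?thesis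
    using 1 2 eventually_gt_at_top[of 0]
  proof eventually_elim
    case (elim n)
    have "chain_gf z n \<le> C * shifted_binomial a n" by (rule C)
    also have "\<dots> \<le> C * ((L + 1) * real n powr a)"
      using elim C by (intro mult_left_mono) (auto simp: divide_less_eq)
    also have "\<dots> = C * (L + 1) * real n powr a" by simp
    also have "\<dots> \<le> real n powr (\<delta> / 2) * real n powr a" using elim by (intro mult_right_mono) auto
    also have "\<dots> = real n powr (growth z + \<delta>)" by (simp add: powr_add[symmetric] a_def add.commute)
    finally show ?case .
  qed
qed

lemma chain_gf_lower:
  assumes z: "z > 0" and "\<delta> > 0"
  shows "\<forall>\<^sub>F n in sequentially. real n powr (growth z - \<delta>) \<le> chain_gf z n"
proof -
  obtain a where a': "max (-1) (growth z - \<delta> / 2) < a" "a < growth z"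
    using dense[of "max (-1) (growth z - \<delta> / 2)" "growth z"] growth_gt[OF z] \<open>\<delta> > 0\<close> by auto
  then have a: "a > -1" "a < growth z" "growth z - \<delta> / 2 < a" by auto
  have "(a + 1) * (a + 2) < 2 * z"
    unfolding growth_root[OF z, symmetric] using a by (intro mult_strict_mono) auto
  then obtain N where N: "\<And>n. n > N \<Longrightarrow> real n * (real n + 1) * shifted_binomial a n \<le> 2 * z * (\<Sum>m<n. real (n - m) * shifted_binomial a m)"
    using shifted_binomial_sub[OF a(1)] by blast
  obtain C where C: "C > 0" "\<And>n. shifted_binomial a n \<le> C * chain_gf z n"
    using linear_convolution_comparison[of z "shifted_binomial a" "chain_gf z" N]
      z chain_gf_pos[OF z] shifted_binomial_pos[OF a(1)] N chain_gf_rec[of _ z] by fastforce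
  obtain L where L: "L > 0" "(\<lambda>n. shifted_binomial a n / real n powr a) \<longlonglongrightarrow> L"
    using shifted_binomial_asymp[OF a(1)] by blast
  have 1: "\<forall>\<^sub>F n in sequentially. L / 2 < shifted_binomial a n / real n powr a"
    using order_tendstoD(1)[OF L(2), of "L / 2"] L(1) by simp
  have 2: "\<forall>\<^sub>F n::nat in sequentially. C * 2 / L \<le> real n powr (\<delta> / 2)"
    using \<open>\<delta> > 0\<close> by real_asymp
  show ?thesis
    using 1 2 eventually_gt_at_top[of 1]
  proof eventually_elim
    case (elim n)
    have "C * real n powr (growth z - \<delta>) = L / 2 * (C * 2 / L * real n powr (growth z - \<delta>))" using L by simp
    also have "\<dots> \<le> L / 2 * (real n powr (\<delta> / 2) * real n powr (growth z - \<delta>))"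
      using elim L by (intro mult_left_mono mult_right_mono) auto
    also have "\<dots> = L / 2 * real n powr (growth z - \<delta> / 2)" by (simp add: powr_add[symmetric])
    also have "\<dots> \<le> L / 2 * real n powr a" using elim L a by (intro mult_left_mono powr_mono) auto
    also have "\<dots> \<le> shifted_binomial a n" using elim by (simp add: less_divide_eq)
    also have "\<dots> \<le> C * chain_gf z n" by (rule C)
    finally show ?case using C by simp
  qed
qed

section \<open>Local large deviations\<close>

text \<open>
  The maximiser z of \<open>c ln z - growth z\<close>, that is the solution of \<open>z growth'(z) = c\<close>.
\<close>

definition tilt :: "real \<Rightarrow> real" where
  "tilt c = c * (2 * c + sqrt (1 + 4 * c\<^sup>2)) / 2"

text \<open>
  The square root in \<open>growth\<close> becomes rational at the maximiser: it equals \<open>w = 2 c + sqrt (1 + 4 c^2)\<close>,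
  whose logarithm is \<open>arsinh (2 c)\<close>. This gives the closed form of the rate function.
\<close>

lemma tilt_properties:
  assumes "c > 0"
  shows tilt_pos: "tilt c > 0"
    and sqrt_tilt: "sqrt (1 + 8 * tilt c) = 2 * c + sqrt (1 + 4 * c\<^sup>2)"
    and rate_eq: "rate c = c * ln (tilt c) - growth (tilt c)"
proof -
  define w where "w = 2 * c + sqrt (1 + 4 * c\<^sup>2)"
  have s: "sqrt (1 + 4 * c\<^sup>2) > 0" by (simp add: add_pos_nonneg)
  have w: "w > 0" unfolding w_def using assms by (intro add_pos_pos s) simp
  have t: "tilt c = c * w / 2" by (simp add: tilt_def w_def)
  show "tilt c > 0" using w assms by (simp add: t)
  have "(w - 2 * c)\<^sup>2 = 1 + 4 * c\<^sup>2" by (simp add: w_def)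
  then have "1 + 8 * tilt c = w\<^sup>2" by (simp add: t power2_eq_square algebra_simps)
  then have sq: "sqrt (1 + 8 * tilt c) = w" using w by simp
  then show "sqrt (1 + 8 * tilt c) = 2 * c + sqrt (1 + 4 * c\<^sup>2)" by (simp add: w_def)
  have "arsinh (2 * c) = ln w"
    by (simp add: arsinh_real_def w_def power_mult_distrib add.commute)
  moreover have "ln (tilt c) = ln (c / 2) + ln w"
    using w assms by (simp add: t ln_mult_pos[symmetric])
  moreover have "growth (tilt c) = c + sqrt (1 + 4 * c\<^sup>2) / 2 - 3 / 2"
    unfolding growth_def sq w_def by (simp add: field_simps)
  ultimately show "rate c = c * ln (tilt c) - growth (tilt c)"
    by (simp add: rate_def algebra_simps)
qed

text \<open>
  At t = 0 the function \<open>t \<mapsto> growth (tilt c exp t)\<close> has slope c. Against a line of slope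
  \<open>c + \<eta>\<close> or \<open>c - \<eta>\<close> it therefore decreases in one direction, and this is the exponential gain in
  the two tails below.
\<close>

lemma growth_tilt_deriv:
  assumes "c > 0"
  shows "((\<lambda>t. growth (tilt c * exp t) - d * t) has_real_derivative (c - d)) (at 0)"
proof -
  have "1 + 8 * tilt c > 0" using tilt_pos[OF assms] by simp
  then have "((\<lambda>t. growth (tilt c * exp t) - d * t) has_real_derivative
      (inverse (sqrt (1 + 8 * tilt c)) / 2 * (8 * tilt c)) / 2 - d) (at 0)"
    unfolding growth_def by (auto intro!: derivative_eq_intros)
  moreover have "(inverse (sqrt (1 + 8 * tilt c)) / 2 * (8 * tilt c)) / 2 = c"
  proof -
    define w where "w = 2 * c + sqrt (1 + 4 * c\<^sup>2)"
    have "w > 0" using assms by (simp add: w_def add_pos_nonneg)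
    then show ?thesis unfolding sqrt_tilt[OF assms] by (simp add: tilt_def w_def[symmetric])
  qed
  ultimately show ?thesis by simp
qed

lemma tail_gap_right:
  assumes "c > 0" "\<eta> > 0"
  shows "\<exists>t>0. growth (tilt c * exp t) - (c + \<eta>) * t < growth (tilt c)"
proof -
  obtain d where d: "d > 0" "\<And>h. h > 0 \<Longrightarrow> h < d \<Longrightarrow>
     growth (tilt c * exp (0 + h)) - (c + \<eta>) * (0 + h) < growth (tilt c * exp 0) - (c + \<eta>) * 0"
    using DERIV_neg_dec_right[OF growth_tilt_deriv[OF assms(1), of "c + \<eta>"]] assms by auto
  from d(2)[of "d / 2"] d(1) show ?thesis by (intro exI[of _ "d / 2"]) auto
qed

lemma tail_gap_left:
  assumes "c > 0" "\<eta> > 0"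
  shows "\<exists>t>0. growth (tilt c * exp (- t)) + (c - \<eta>) * t < growth (tilt c)"
proof -
  obtain d where d: "d > 0" "\<And>h. h > 0 \<Longrightarrow> h < d \<Longrightarrow>
     growth (tilt c * exp (0 - h)) - (c - \<eta>) * (0 - h) < growth (tilt c * exp 0) - (c - \<eta>) * 0"
    using DERIV_pos_inc_left[OF growth_tilt_deriv[OF assms(1), of "c - \<eta>"]] assms by auto
  from d(2)[of "d / 2"] d(1) show ?thesis by (intro exI[of _ "d / 2"]) auto
qed

text \<open>
  The weights \<open>chain_prob k n z^k\<close> with \<open>z = tilt c\<close> sum to about \<open>n^(growth z)\<close>. A further tilt in
  either direction shows that the values k outside the window contribute a smaller power of n. The
  window has only logarithmically many values, so one of them carries \<open>n^(growth z - o(1))\<close>.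
\<close>

lemma exists_likely_value_in_window:
  assumes c: "c > 0" and \<epsilon>: "\<epsilon> > 0"
  shows "\<forall>\<^sub>F n in sequentially. \<exists>k. \<bar>real k - c * ln (real n)\<bar> \<le> \<epsilon> * ln (real n) \<and>
           real n powr (- rate c - \<epsilon>) \<le> chain_prob k n"
proof -
  define z where "z = tilt c"
  have z: "z > 0" using tilt_pos[OF c] by (simp add: z_def)
  \<comment> \<open>In a window of half-width \<open>\<eta> ln n\<close> the factor \<open>z^k\<close> varies by at most \<open>n^(\<epsilon>/2)\<close>.\<close>
  define \<eta> where "\<eta> = \<epsilon> / (2 * (1 + \<bar>ln z\<bar>))"
  have \<eta>: "\<eta> > 0" using \<epsilon> by (simp add: \<eta>_def)
  have \<eta>z: "\<eta> * \<bar>ln z\<bar> \<le> \<epsilon> / 2" "\<eta> \<le> \<epsilon>"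
    using \<epsilon> by (simp_all add: \<eta>_def field_simps)
  obtain t where t: "t > 0" "growth (z * exp t) - (c + \<eta>) * t < growth z"
    using tail_gap_right[OF c \<eta>] by (auto simp: z_def)
  obtain s where s: "s > 0" "growth (z * exp (- s)) + (c - \<eta>) * s < growth z"
    using tail_gap_left[OF c \<eta>] by (auto simp: z_def)
  define \<delta> where "\<delta> = Min {\<epsilon> / 4, (growth z - (growth (z * exp t) - (c + \<eta>) * t)) / 3,
      (growth z - (growth (z * exp (- s)) + (c - \<eta>) * s)) / 3}"
  have \<delta>: "\<delta> > 0" using \<epsilon> t s by (simp add: \<delta>_def)
  have \<delta>le: "\<delta> \<le> \<epsilon> / 4" "growth (z * exp t) - (c + \<eta>) * t + \<delta> \<le> growth z - 2 * \<delta>"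
    "growth (z * exp (- s)) + (c - \<eta>) * s + \<delta> \<le> growth z - 2 * \<delta>"
  proof -
    show "\<delta> \<le> \<epsilon> / 4" by (simp add: \<delta>_def)
    have "\<delta> \<le> (growth z - (growth (z * exp t) - (c + \<eta>) * t)) / 3"
      "\<delta> \<le> (growth z - (growth (z * exp (- s)) + (c - \<eta>) * s)) / 3"
      unfolding \<delta>_def by (rule Min_le; simp)+
    then show "growth (z * exp t) - (c + \<eta>) * t + \<delta> \<le> growth z - 2 * \<delta>"
      "growth (z * exp (- s)) + (c - \<eta>) * s + \<delta> \<le> growth z - 2 * \<delta>" by simp_all
  qed
  have asy: "\<forall>\<^sub>F n::nat in sequentially. (c + \<eta>) * ln (real n) + 3 < real n powr \<delta>"
    using \<delta> c \<eta> by real_asymp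
  have zt: "z * exp t > 0" "z * exp (- s) > 0" using z by auto
  show ?thesis
    using asy chain_gf_lower[OF z \<delta>] chain_gf_upper[OF zt(1) \<delta>] chain_gf_upper[OF zt(2) \<delta>] eventually_gt_at_top[of 1]
  proof eventually_elim
    case (elim n)
    define L where "L = ln (real n)"
    have L: "L > 0" using elim by (simp add: L_def)
    have n: "real n > 1" using elim by simp
    have e: "exp (x * L) = real n powr x" for x using n by (simp add: L_def powr_def)
    let ?q = "\<lambda>k. chain_prob k n"
    define Ri where "Ri = {k\<in>{..n}. (c + \<eta>) * L < real k}"
    define Le where "Le = {k\<in>{..n}. real k < (c - \<eta>) * L}"
    define Md where "Md = {k\<in>{..n}. (c - \<eta>) * L \<le> real k \<and> real k \<le> (c + \<eta>) * L}"
    show ?case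
    proof (rule ccontr)
      assume "\<not> ?case"
      then have small: "?q k < real n powr (- rate c - \<epsilon>)" if "k \<in> Md" for k
      proof -
        have "\<eta> * L \<le> \<epsilon> * L" using \<eta>z L by simp
        then have near: "\<bar>real k - c * L\<bar> \<le> \<epsilon> * L" using that by (auto simp: Md_def abs_le_iff algebra_simps)
        show ?thesis
        proof (rule ccontr)
          assume "\<not> ?thesis"
          then have "real n powr (- rate c - \<epsilon>) \<le> chain_prob k n" by simp
          with near \<open>\<not> ?case\<close> show False unfolding L_def by blast
        qed
      qed
      have R: "(\<Sum>k\<in>Ri. ?q k * z ^ k) \<le> real n powr (growth z - 2 * \<delta>)"
      proof -
        have "(\<Sum>k\<in>Ri. ?q k * z ^ k) \<le> (\<Sum>k\<in>Ri. exp (- (c + \<eta>) * t * L) * (?q k * (z * exp t) ^ k))"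
        proof (rule sum_mono)
          fix k assume "k \<in> Ri"
          then have "t * ((c + \<eta>) * L) \<le> t * real k" using t by (auto simp: Ri_def)
          then have "1 \<le> exp (- (c + \<eta>) * t * L) * exp (t * real k)"
            by (simp add: exp_add[symmetric] algebra_simps)
          then have "(?q k * z ^ k) * 1 \<le> (?q k * z ^ k) * (exp (- (c + \<eta>) * t * L) * exp (t * real k))"
            using z chain_prob_nonneg by (intro mult_left_mono) auto
          then show "?q k * z ^ k \<le> exp (- (c + \<eta>) * t * L) * (?q k * (z * exp t) ^ k)"
            by (simp add: power_mult_distrib exp_of_nat2_mult[symmetric] ac_simps)
        qed
        also have "\<dots> \<le> (\<Sum>k\<le>n. exp (- (c + \<eta>) * t * L) * (?q k * (z * exp t) ^ k))"
          by (rule sum_mono2) (use z chain_prob_nonneg in \<open>auto simp: Ri_def\<close>)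
        also have "\<dots> = exp (- (c + \<eta>) * t * L) * chain_gf (z * exp t) n"
          by (simp add: chain_gf_def sum_distrib_left)
        also have "\<dots> \<le> real n powr (- (c + \<eta>) * t) * real n powr (growth (z * exp t) + \<delta>)"
          using elim by (simp only: e) (rule mult_left_mono, auto)
        also have "\<dots> = real n powr (growth (z * exp t) - (c + \<eta>) * t + \<delta>)"
          by (simp add: powr_add[symmetric] algebra_simps)
        also have "\<dots> \<le> real n powr (growth z - 2 * \<delta>)" using n \<delta>le by (intro powr_mono) auto
        finally show ?thesis .
      qed
      have Lf: "(\<Sum>k\<in>Le. ?q k * z ^ k) \<le> real n powr (growth z - 2 * \<delta>)"
      proof -
        have "(\<Sum>k\<in>Le. ?q k * z ^ k) \<le> (\<Sum>k\<in>Le. exp ((c - \<eta>) * s * L) * (?q k * (z * exp (- s)) ^ k))"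
        proof (rule sum_mono)
          fix k assume "k \<in> Le"
          then have "s * real k \<le> s * ((c - \<eta>) * L)" using s by (auto simp: Le_def)
          then have "1 \<le> exp ((c - \<eta>) * s * L) * exp (- s * real k)"
            by (simp add: exp_add[symmetric] algebra_simps)
          then have "(?q k * z ^ k) * 1 \<le> (?q k * z ^ k) * (exp ((c - \<eta>) * s * L) * exp (- s * real k))"
            using z chain_prob_nonneg by (intro mult_left_mono) auto
          then show "?q k * z ^ k \<le> exp ((c - \<eta>) * s * L) * (?q k * (z * exp (- s)) ^ k)"
            by (simp add: power_mult_distrib exp_of_nat2_mult[symmetric] ac_simps)
        qed
        also have "\<dots> \<le> (\<Sum>k\<le>n. exp ((c - \<eta>) * s * L) * (?q k * (z * exp (- s)) ^ k))"
          by (rule sum_mono2) (use z chain_prob_nonneg in \<open>auto simp: Le_def\<close>)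
        also have "\<dots> = exp ((c - \<eta>) * s * L) * chain_gf (z * exp (- s)) n"
          by (simp add: chain_gf_def sum_distrib_left)
        also have "\<dots> \<le> real n powr ((c - \<eta>) * s) * real n powr (growth (z * exp (- s)) + \<delta>)"
          using elim by (simp only: e) (rule mult_left_mono, auto)
        also have "\<dots> = real n powr (growth (z * exp (- s)) + (c - \<eta>) * s + \<delta>)"
          by (simp add: powr_add[symmetric] algebra_simps)
        also have "\<dots> \<le> real n powr (growth z - 2 * \<delta>)" using n \<delta>le by (intro powr_mono) auto
        finally show ?thesis .
      qed
      have Mdsum: "(\<Sum>k\<in>Md. ?q k * z ^ k) \<le> ((c + \<eta>) * L + 1) * real n powr (growth z - 2 * \<delta>)"
      proof -
        have "(\<Sum>k\<in>Md. ?q k * z ^ k) \<le> (\<Sum>k\<in>Md. real n powr (growth z - 2 * \<delta>))"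
        proof (rule sum_mono)
          fix k assume k: "k \<in> Md"
          have "(real k - c * L) * ln z \<le> \<bar>real k - c * L\<bar> * \<bar>ln z\<bar>"
            by (simp add: abs_mult[symmetric])
          also have "\<dots> \<le> (\<eta> * L) * \<bar>ln z\<bar>"
            using k by (intro mult_right_mono) (auto simp: Md_def abs_le_iff algebra_simps)
          also have "\<dots> = (\<eta> * \<bar>ln z\<bar>) * L" by simp
          also have "\<dots> \<le> \<epsilon> / 2 * L" using L \<eta>z by (intro mult_right_mono) auto
          finally have "real k * ln z \<le> (c * ln z + \<epsilon> / 2) * L" by (simp add: algebra_simps)
          then have "exp (real k * ln z) \<le> real n powr (c * ln z + \<epsilon> / 2)"
            unfolding e[symmetric] by simp
          then have "z ^ k \<le> real n powr (c * ln z + \<epsilon> / 2)"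
            using z by (simp add: exp_of_nat_mult)
          then have "?q k * z ^ k \<le> real n powr (- rate c - \<epsilon>) * real n powr (c * ln z + \<epsilon> / 2)"
            using small[OF k] z by (intro mult_mono) auto
          also have "\<dots> = real n powr ((- rate c - \<epsilon>) + (c * ln z + \<epsilon> / 2))"
            by (simp only: powr_add)
          also have "(- rate c - \<epsilon>) + (c * ln z + \<epsilon> / 2) = growth z - \<epsilon> / 2"
            using rate_eq[OF c] by (simp add: z_def)
          also have "real n powr (growth z - \<epsilon> / 2) \<le> real n powr (growth z - 2 * \<delta>)"
            using n \<delta>le by (intro powr_mono) auto
          finally show "?q k * z ^ k \<le> real n powr (growth z - 2 * \<delta>)" .
        qed
        also have "\<dots> = real (card Md) * real n powr (growth z - 2 * \<delta>)" by simp
        also have "\<dots> \<le> ((c + \<eta>) * L + 1) * real n powr (growth z - 2 * \<delta>)"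
        proof (rule mult_right_mono)
          have "Md \<subseteq> {..nat \<lfloor>(c + \<eta>) * L\<rfloor>}" by (auto simp: Md_def le_nat_floor)
          then have "card Md \<le> card {..nat \<lfloor>(c + \<eta>) * L\<rfloor>}" by (intro card_mono) auto
          also have "\<dots> = nat \<lfloor>(c + \<eta>) * L\<rfloor> + 1" by simp
          finally have "real (card Md) \<le> real (nat \<lfloor>(c + \<eta>) * L\<rfloor>) + 1" by linarith
          also have "real (nat \<lfloor>(c + \<eta>) * L\<rfloor>) \<le> (c + \<eta>) * L" using c \<eta> L by (intro of_nat_floor) auto
          finally show "real (card Md) \<le> (c + \<eta>) * L + 1" by simp
        qed auto
        finally show ?thesis .
      qed
      have split: "{..n} = Le \<union> (Md \<union> Ri)" by (auto simp: Le_def Md_def Ri_def)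
      have "(c - \<eta>) * L \<le> (c + \<eta>) * L" using \<eta> L by (intro mult_right_mono) auto
      then have disj: "Md \<inter> Ri = {}" "Le \<inter> (Md \<union> Ri) = {}" by (auto simp: Le_def Md_def Ri_def)
      have fin: "finite Le" "finite Md" "finite Ri" by (auto simp: Le_def Md_def Ri_def)
      have "chain_gf z n = (\<Sum>k\<in>Le. ?q k * z ^ k) + ((\<Sum>k\<in>Md. ?q k * z ^ k) + (\<Sum>k\<in>Ri. ?q k * z ^ k))"
        unfolding chain_gf_def split using disj fin by (simp add: sum.union_disjoint)
      also have "\<dots> \<le> real n powr (growth z - 2 * \<delta>) + (((c + \<eta>) * L + 1) * real n powr (growth z - 2 * \<delta>) + real n powr (growth z - 2 * \<delta>))"
        using R Lf Mdsum by (intro add_mono)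
      also have "\<dots> = ((c + \<eta>) * L + 3) * real n powr (growth z - 2 * \<delta>)" by (simp add: algebra_simps)
      also have "\<dots> < real n powr \<delta> * real n powr (growth z - 2 * \<delta>)"
        using elim n by (intro mult_strict_right_mono) (auto simp: L_def)
      also have "\<dots> = real n powr (growth z - \<delta>)" by (simp add: powr_add[symmetric])
      also have "\<dots> \<le> chain_gf z n" using elim by simp
      finally show False by simp
    qed
  qed
qed

text \<open>
  This is the Chernoff bound \<open>chain_prob k n \<le> z^(-k) chain_gf z n\<close> at \<open>z = tilt c\<close>. Rounding \<open>c ln n\<close>
  down costs at most the constant factor \<open>exp \<bar>ln z\<bar>\<close>.
\<close>

lemma chain_prob_upper:
  assumes c: "c > 0" and \<epsilon>: "\<epsilon> > 0"
  shows "\<forall>\<^sub>F n in sequentially. chain_prob (nat \<lfloor>c * ln (real n)\<rfloor>) n \<le> real n powr (- rate c + \<epsilon>)"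
proof -
  define z where "z = tilt c"
  have z: "z > 0" using tilt_pos[OF c] by (simp add: z_def)
  have "\<epsilon> / 2 > 0" using \<epsilon> by simp
  have asy: "\<forall>\<^sub>F n::nat in sequentially. exp \<bar>ln z\<bar> \<le> real n powr (\<epsilon> / 2)"
    using \<epsilon> by real_asymp
  have asy2: "\<forall>\<^sub>F n::nat in sequentially. c * ln (real n) \<le> real n"
    using c by real_asymp
  show ?thesis
    using asy asy2 chain_gf_upper[OF z \<open>\<epsilon> / 2 > 0\<close>] eventually_gt_at_top[of 1]
  proof eventually_elim
    case (elim n)
    define L k where "L = ln (real n)" and "k = nat \<lfloor>c * L\<rfloor>"
    have L: "L > 0" and n: "real n > 1" using elim by (simp_all add: L_def)
    have e: "exp (x * L) = real n powr x" for x using n by (simp add: L_def powr_def)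
    have k: "real k \<le> c * L" "c * L - 1 \<le> real k"
      using c L by (auto simp: k_def of_nat_floor)
    then have "k \<le> n" using elim(2) unfolding L_def by linarith
    have "(c * L - real k) * ln z \<le> \<bar>c * L - real k\<bar> * \<bar>ln z\<bar>"
      by (simp add: abs_mult[symmetric])
    also have "\<dots> \<le> 1 * \<bar>ln z\<bar>" using k by (intro mult_right_mono) auto
    finally have "(c * ln z) * L \<le> real k * ln z + \<bar>ln z\<bar>" by (simp add: algebra_simps)
    then have "exp ((c * ln z) * L) \<le> exp (real k * ln z + \<bar>ln z\<bar>)" by simp
    also have "\<dots> = z ^ k * exp \<bar>ln z\<bar>" using z by (simp add: exp_add exp_of_nat_mult)
    finally have zk: "real n powr (c * ln z) \<le> z ^ k * exp \<bar>ln z\<bar>" by (simp only: e)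
    have "chain_prob k n * z ^ k \<le> chain_gf z n" unfolding chain_gf_def
      by (rule member_le_sum[of k "{..n}" "\<lambda>k. chain_prob k n * z ^ k"]) (use \<open>k \<le> n\<close> z chain_prob_nonneg in auto)
    also have "\<dots> \<le> real n powr (growth z + \<epsilon> / 2)" using elim by simp
    finally have g: "chain_prob k n * z ^ k \<le> real n powr (growth z + \<epsilon> / 2)" .
    have "chain_prob k n * real n powr (c * ln z) \<le> chain_prob k n * (z ^ k * exp \<bar>ln z\<bar>)"
      by (rule mult_left_mono[OF zk chain_prob_nonneg])
    also have "\<dots> = (chain_prob k n * z ^ k) * exp \<bar>ln z\<bar>" by simp
    also have "\<dots> \<le> real n powr (growth z + \<epsilon> / 2) * real n powr (\<epsilon> / 2)"
      using g elim by (intro mult_mono) auto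
    also have "growth z + \<epsilon> / 2 = (- rate c + \<epsilon> / 2) + c * ln z" using rate_eq[OF c] by (simp add: z_def)
    also have "real n powr \<dots> * real n powr (\<epsilon> / 2) = real n powr (- rate c + \<epsilon>) * real n powr (c * ln z)"
      by (simp only: powr_add[symmetric]) (simp add: algebra_simps)
    finally show ?case using n by (simp add: k_def L_def)
  qed
qed

text \<open>
  The two windows around \<open>(c - 2\<eta>) ln n\<close> and \<open>(c + 2\<eta>) ln n\<close> lie on the two sides of the floor of
  \<open>c ln n\<close>, and by continuity the rate there is close to \<open>rate c\<close>. A log-concave sequence is at least
  as large in between as at the smaller end.
\<close>

lemma chain_prob_lower:
  assumes c: "c > 0" and \<epsilon>: "\<epsilon> > 0"
  shows "\<forall>\<^sub>F n in sequentially. real n powr (- rate c - \<epsilon>) \<le> chain_prob (nat \<lfloor>c * ln (real n)\<rfloor>) n"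
proof -
  have "isCont rate c"
    unfolding rate_def using c by (intro continuous_intros) auto
  then have "\<forall>\<^sub>F x in at c. rate x < rate c + \<epsilon> / 2"
    using \<epsilon> by (intro order_tendstoD(2)[of rate "rate c"]) (auto simp: isCont_def)
  then obtain d where d: "d > 0" and near: "\<And>x. x \<noteq> c \<Longrightarrow> dist x c < d \<Longrightarrow> rate x < rate c + \<epsilon> / 2"
    unfolding eventually_at by auto
  define \<eta> where "\<eta> = Min {d / 4, c / 4, \<epsilon> / 2}"
  have \<eta>: "\<eta> > 0" "\<eta> \<le> d / 4" "\<eta> \<le> c / 4" "\<eta> \<le> \<epsilon> / 2" using d c \<epsilon> by (auto simp: \<eta>_def)
  have pos: "c - 2 * \<eta> > 0" "c + 2 * \<eta> > 0" using \<eta> c by auto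
  have rates: "rate (c - 2 * \<eta>) < rate c + \<epsilon> / 2" "rate (c + 2 * \<eta>) < rate c + \<epsilon> / 2"
    using \<eta> d by (auto intro!: near simp: dist_real_def)
  have asy: "\<forall>\<^sub>F n::nat in sequentially. 1 \<le> \<eta> * ln (real n)"
    using \<eta> by real_asymp
  show ?thesis
    using exists_likely_value_in_window[OF pos(1) \<eta>(1)] exists_likely_value_in_window[OF pos(2) \<eta>(1)]
      asy eventually_gt_at_top[of 1]
  proof eventually_elim
    case (elim n)
    define L k where "L = ln (real n)" and "k = nat \<lfloor>c * L\<rfloor>"
    have L: "L > 0" and n: "real n > 1" using elim by (simp_all add: L_def)
    obtain l where l: "\<bar>real l - (c - 2 * \<eta>) * L\<bar> \<le> \<eta> * L" "real n powr (- rate (c - 2 * \<eta>) - \<eta>) \<le> chain_prob l n"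
      using elim(1) unfolding L_def by blast
    obtain r where r: "\<bar>real r - (c + 2 * \<eta>) * L\<bar> \<le> \<eta> * L" "real n powr (- rate (c + 2 * \<eta>) - \<eta>) \<le> chain_prob r n"
      using elim(2) unfolding L_def by blast
    have "real l \<le> c * L - \<eta> * L" using l(1) by (simp add: abs_le_iff algebra_simps)
    moreover have "1 \<le> \<eta> * L" using elim by (simp add: L_def)
    moreover have "c * L < real k + 1" unfolding k_def by linarith
    ultimately have "l \<le> k" by linarith
    have "c * L \<le> real r" using r(1) \<open>1 \<le> \<eta> * L\<close> by (simp add: abs_le_iff algebra_simps)
    moreover have "real k \<le> c * L" unfolding k_def using c L by (intro of_nat_floor) auto
    ultimately have "k \<le> r" by linarith
    have low: "real n powr (- rate c - \<epsilon>) \<le> real n powr (- rate (c - 2 * \<eta>) - \<eta>)"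
       "real n powr (- rate c - \<epsilon>) \<le> real n powr (- rate (c + 2 * \<eta>) - \<eta>)"
      using n rates \<eta> by (auto intro!: powr_mono)
    then have lr: "real n powr (- rate c - \<epsilon>) \<le> chain_prob l n" "real n powr (- rate c - \<epsilon>) \<le> chain_prob r n"
      using l r by auto
    moreover have "real n powr (- rate c - \<epsilon>) > 0" using n by simp
    ultimately have "chain_prob l n > 0" "chain_prob r n > 0" by linarith+
    have "l > 0"
    proof (rule ccontr)
      assume "\<not> l > 0"
      then have "chain_prob l n = 0" using n by simp
      with \<open>chain_prob l n > 0\<close> show False by simp
    qed
    have "r \<le> n"
    proof (rule ccontr)
      assume "\<not> r \<le> n"
      then have "chain_prob r n = 0" by (intro chain_prob_eq_0) simp
      with \<open>chain_prob r n > 0\<close> show False by simp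
    qed
    have "min (chain_prob l n) (chain_prob r n) \<le> chain_prob k n"
    proof (rule log_concave_imp_min_le[where a = "\<lambda>k. chain_prob k n"])
      show "0 < chain_prob i n" if "l \<le> i" "i \<le> r" for i
        using that \<open>l > 0\<close> \<open>r \<le> n\<close> by (intro chain_prob_pos) auto
    qed (use chain_prob_log_concave \<open>l \<le> k\<close> \<open>k \<le> r\<close> in auto)
    with lr show ?case by (simp add: k_def L_def min_def split: if_splits)
  qed
qed

lemma exponent_exists:
  fixes p :: "nat \<Rightarrow> real"
  assumes lower: "\<And>\<delta>. \<delta> > 0 \<Longrightarrow> \<forall>\<^sub>F n in sequentially. real n powr (r - \<delta>) \<le> p n"
    and upper: "\<And>\<delta>. \<delta> > 0 \<Longrightarrow> \<forall>\<^sub>F n in sequentially. p n \<le> real n powr (r + \<delta>)"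
  shows "\<exists>\<epsilon>. \<epsilon> \<longlonglongrightarrow> 0 \<and> (\<forall>\<^sub>F n in sequentially. p n = real n powr (r + \<epsilon> n))"
proof (intro exI conjI)
  define \<epsilon> where "\<epsilon> = (\<lambda>n. log (real n) (p n) - r)"
  have pos: "\<forall>\<^sub>F n in sequentially. 0 < p n"
    using lower[of 1, OF zero_less_one] eventually_gt_at_top[of 0]
  proof eventually_elim
    case (elim n)
    then have "0 < real n powr (r - 1)" by simp
    with elim show ?case by linarith
  qed
  show "\<forall>\<^sub>F n in sequentially. p n = real n powr (r + \<epsilon> n)"
    using pos eventually_gt_at_top[of 1] by eventually_elim (simp add: \<epsilon>_def)
  show "\<epsilon> \<longlonglongrightarrow> 0"
  proof (rule tendstoI)
    fix e :: real assume "e > 0"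
    then have e: "e / 2 > 0" by simp
    show "\<forall>\<^sub>F n in sequentially. dist (\<epsilon> n) 0 < e"
      using lower[OF e] upper[OF e] pos eventually_gt_at_top[of 1]
    proof eventually_elim
      case (elim n)
      have "r - e / 2 \<le> log (real n) (p n)" using elim by (simp add: le_log_iff)
      moreover have "log (real n) (p n) \<le> r + e / 2" using elim by (simp add: log_le_iff)
      ultimately show ?case using \<open>e > 0\<close> by (simp add: \<epsilon>_def dist_real_def abs_less_iff)
    qed
  qed
qed

theorem proposition3p14:
  fixes M :: "nat \<Rightarrow> 'a measure"
    and X :: "nat \<Rightarrow> nat \<Rightarrow> 'a \<Rightarrow> real \<times> real"
    and c :: real
  assumes "\<And>n. prob_space (M n)"
    and "\<And>n. prob_space.indep_vars (M n) (\<lambda>_. borel) (X n) {1..n}"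
    and "\<And>n i. i \<in> {1..n} \<Longrightarrow> distr (M n) borel (X n i) = uniform_measure lborel T"
    and "c > 0"
  shows "\<exists>\<epsilon> :: nat \<Rightarrow> real. \<epsilon> \<longlonglongrightarrow> 0 \<and>
    (\<forall>\<^sub>F n in sequentially.
      vertex_prob (M n) (X n) n (nat \<lfloor>c * ln (real n)\<rfloor>) = real n powr (- rate c + \<epsilon> n))"
proof -
  let ?k = "\<lambda>n. nat \<lfloor>c * ln (real n)\<rfloor>"
  have "\<exists>\<epsilon>. \<epsilon> \<longlonglongrightarrow> 0 \<and>
      (\<forall>\<^sub>F n in sequentially. chain_prob (?k n) n = real n powr (- rate c + \<epsilon> n))"
    by (rule exponent_exists) (rule chain_prob_lower[OF assms(4)] chain_prob_upper[OF assms(4)], assumption)+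
  then obtain \<epsilon> where lim: "\<epsilon> \<longlonglongrightarrow> 0"
    and eq: "\<forall>\<^sub>F n in sequentially. chain_prob (?k n) n = real n powr (- rate c + \<epsilon> n)"
    by blast
  have "\<forall>\<^sub>F n in sequentially. vertex_prob (M n) (X n) n (?k n) = real n powr (- rate c + \<epsilon> n)"
    using eq eventually_gt_at_top[of 0]
  proof eventually_elim
    case (elim n)
    then show ?case
      using vertex_prob_eq_chain_prob[OF assms(1,2,3), of n "?k n"] by simp
  qed
  with lim show ?thesis by blast
qed

end
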